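(* Let $n\ge k>0$ be integers, let $P_{n+k+1}$ be a convex $(n+k+1)$-gon with a chosen vertex $v_0$, and label the vertices of $P_{n+k+1}$ clockwise by $1,2,\dots,n+k+1$ starting from $v_0$. Let $\mathrm{Dis}(P_{n+k+1})$ be the set of all $k$-dissections of $P_{n+k+1}$ and let $D_0$ be the minimal $k$-dissection. Put $$\mathcal{T}_{P_{n+k+1}}(X_{n+k+1})=\sum_{D\in\mathrm{Dis}(P_{n+k+1})}\beta^{\#|D\setminus D_0|}\prod_{d_{ij}\in D\setminus D_0,\ i<j}x_i,$$ where $d_{ij}$, $i<j$, denotes the diagonal joining the vertices labeled $i$ and $j$, to which the variable $x_i$ is attached. Then $$\mathcal{T}_{P_{n+k+1}}(X_{n+k+1})=\beta^{k(n-k)}\prod_{a=1}^{n}x_a^{\min(n-a+1,\,n-k)}\ \mathfrak{G}^{(\beta^{-1})}_{w_k^{(n)}}\bigl(x_1^{-1},\dots,x_n^{-1}\bigr),$$ where $w_k^{(n)}=1^k\times w_0^{(n-k)}\in\mathbb{S}_n$.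
   Context: A $k$-dissection of a convex $(n+k+1)$-gon is a collection of diagonals which contains no $(k+1)$-subset of pairwise crossing diagonals and is such that at least $2(k-1)$ diagonals of the collection come from each vertex of the $(n+k+1)$-gon. The minimal $k$-dissection $D_0$ is the set of diagonals connecting the vertices labeled $a$ and $\overline{a+r}$, where $2\le r\le k$, $1\le a\le n+k+1$, and for a positive integer $b$, $\overline{b}$ is the unique integer with $1\le\overline{b}\le n+k+1$ and $b\equiv\overline{b}\pmod{n+k+1}$. $w_k^{(n)}=1^k\times w_0^{(n-k)}\in\mathbb{S}_n$ is the permutation fixing $1,\dots,k$ and sending $k+a\mapsto n+1-a$ for $1\le a\le n-k$. $\beta$-Grothendieck polynomials: let $\mathrm{IdC}_m(\beta)$ be the associative $\mathbb{Z}[\beta]$-algebra with generators $e_1,\dots,e_{m-1}$ and relations $e_ie_j=e_je_i$ if $|i-j|\ge2$, $e_ie_je_i=e_je_ie_j$ if $|i-j|=1$, $e_i^2=\beta e_i$. For $w\in\mathbb{S}_m$ put $e_w=e_{i_1}\cdots e_{i_\ell}$ for any reduced word $w=s_{i_1}\cdots s_{i_\ell}$, where $s_i=(i,i+1)$. With commuting variables $x_i$ which commute with all $e_j$, $h_i(x)=1+xe_i$ and $A_i(x)=h_{m-1}(x)\cdots h_i(x)$, the polynomials $\mathfrak{G}_w^{(\beta)}$ are defined by $A_1(x_1)\cdots A_{m-1}(x_{m-1})=\sum_{w\in\mathbb{S}_m}\mathfrak{G}_w^{(\beta)}(x_1,\dots,x_{m-1})e_w$; $\mathfrak{G}_w^{(\beta^{-1})}$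 means that $\beta$ is replaced by $\beta^{-1}$.
   Formalization: The permutation is w_k^{(n+1)} in S_{n+1} instead of w_k^{(n)} in S_n (the printed identity fails for all n>k, e.g. n=2, k=1), and k-dissections are additionally required to contain D_0, which the degree condition alone does not force (e.g. k=2, n=3). *)

theory Defs
  imports "HOL-Library.Poly_Mapping" "HOL-Combinatorics.Permutations"
begin

text \<open>
  The ring of polynomials over the integers in \<open>\<beta>, x\<^sub>1, x\<^sub>2, \<dots>\<close>. A monomial is a finitely supported
  exponent vector; index 0 is \<open>\<beta>\<close> and index \<open>i \<ge> 1\<close> is \<open>x\<^sub>i\<close>.
\<close>

type_synonym poly = "(nat \<Rightarrow>\<^sub>0 nat) \<Rightarrow>\<^sub>0 int"

definition pvar :: "nat \<Rightarrow> poly" where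
  "pvar i = Poly_Mapping.single (Poly_Mapping.single i 1) 1"

abbreviation pbeta :: poly where
  "pbeta \<equiv> pvar 0"

definition poly_subst :: "(nat \<Rightarrow> 'r::comm_ring_1) \<Rightarrow> poly \<Rightarrow> 'r" where
  "poly_subst v p =
     (\<Sum>m\<in>Poly_Mapping.keys p. of_int (Poly_Mapping.lookup p m) *
        (\<Prod>i\<in>Poly_Mapping.keys m. v i ^ Poly_Mapping.lookup m i))"

text \<open>
  The ring of Laurent polynomials over the integers in the same variables: exponents may be
  negative.
\<close>

type_synonym laurent = "(nat \<Rightarrow>\<^sub>0 int) \<Rightarrow>\<^sub>0 int"

definition lvar :: "nat \<Rightarrow> laurent" where
  "lvar i = Poly_Mapping.single (Poly_Mapping.single i 1) 1"

definition lvar_inv :: "nat \<Rightarrow> laurent" where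
  "lvar_inv i = Poly_Mapping.single (Poly_Mapping.single i (- 1)) 1"

lemma lvar_lvar_inv: "lvar i * lvar_inv i = 1"
  by (simp add: lvar_def lvar_inv_def mult_single flip: single_add)

text \<open>
  Diagonals of the convex \<open>N\<close>-gon with vertices labelled \<open>1, \<dots>, N\<close> in cyclic order. The diagonal
  joining \<open>i < j\<close> is the pair \<open>(i, j)\<close>; sides are not diagonals.
\<close>

definition diagonals :: "nat \<Rightarrow> (nat \<times> nat) set" where
  "diagonals N = {(i, j). 1 \<le> i \<and> i + 2 \<le> j \<and> j \<le> N \<and> (i, j) \<noteq> (1, N)}"

definition crossing :: "nat \<times> nat \<Rightarrow> nat \<times> nat \<Rightarrow> bool" where
  "crossing d e \<longleftrightarrow>
     (fst d < fst e \<and> fst e < snd d \<and> snd d < snd e) \<or>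
     (fst e < fst d \<and> fst d < snd e \<and> snd e < snd d)"

definition cyc :: "nat \<Rightarrow> nat \<Rightarrow> nat" where
  "cyc N b = (THE c. 1 \<le> c \<and> c \<le> N \<and> b mod N = c mod N)"

definition minimal_dissection :: "nat \<Rightarrow> nat \<Rightarrow> (nat \<times> nat) set" where
  "minimal_dissection k N =
     {(i, j). i < j \<and>
        (\<exists>a r. 1 \<le> a \<and> a \<le> N \<and> 2 \<le> r \<and> r \<le> k \<and> {i, j} = {a, cyc N (a + r)})}"

text \<open>
  The last condition makes \<open>minimal_dissection k N\<close> the least \<open>k\<close>-dissection. It does not follow
  from the degree condition: for \<open>k = 2\<close> and \<open>N = 6\<close>, removing \<open>(1, 5)\<close> from the short diagonals
  and adding \<open>(1, 4)\<close> and \<open>(2, 5)\<close> leaves two diagonals or more at each vertex. Conversely, for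
  \<open>N \<ge> 2 * k + 1\<close> the degree condition follows from the last one.
\<close>

definition k_dissection :: "nat \<Rightarrow> nat \<Rightarrow> (nat \<times> nat) set \<Rightarrow> bool" where
  "k_dissection k N D \<longleftrightarrow>
     D \<subseteq> diagonals N \<and>
     \<not> (\<exists>S\<subseteq>D. card S = k + 1 \<and> (\<forall>d\<in>S. \<forall>e\<in>S. d \<noteq> e \<longrightarrow> crossing d e)) \<and>
     (\<forall>v\<in>{1..N}. 2 * (k - 1) \<le> card {d \<in> D. fst d = v \<or> snd d = v}) \<and>
     minimal_dissection k N \<subseteq> D"

definition dissection_poly :: "nat \<Rightarrow> nat \<Rightarrow> poly" where
  "dissection_poly k N =
     (\<Sum>D | k_dissection k N D.
        pbeta ^ card (D - minimal_dissection k N) *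
        (\<Prod>(i, j)\<in>D - minimal_dissection k N. pvar i))"

text \<open>
  The free associative algebra over \<open>poly\<close> on \<open>e\<^sub>0, e\<^sub>1, \<dots>\<close> is the monoid algebra of the monoid of
  words under concatenation.
\<close>

datatype ncword = NCWord (letters: "nat list")

instantiation ncword :: monoid_add
begin

definition zero_ncword :: ncword where
  "0 = NCWord []"

definition plus_ncword :: "ncword \<Rightarrow> ncword \<Rightarrow> ncword" where
  "u + v = NCWord (letters u @ letters v)"

instance
  by standard (simp_all add: zero_ncword_def plus_ncword_def)

end

type_synonym free_alg = "ncword \<Rightarrow>\<^sub>0 poly"

definition scalar :: "poly \<Rightarrow> free_alg" where
  "scalar c = Poly_Mapping.single 0 c"

definition word_elem :: "nat list \<Rightarrow> free_alg" where
  "word_elem u = Poly_Mapping.single (NCWord u) 1"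

abbreviation gen :: "nat \<Rightarrow> free_alg" where
  "gen i \<equiv> word_elem [i]"

definition free_alg_on :: "nat \<Rightarrow> free_alg set" where
  "free_alg_on m = {p. \<forall>u\<in>Poly_Mapping.keys p. set (letters u) \<subseteq> {1..<m}}"

text \<open>
  \<open>idc_ideal m\<close> is the two-sided ideal of \<open>free_alg_on m\<close> generated by the relations of
  \<open>IdC\<^sub>m(\<beta>)\<close>. Since the coefficients are polynomials in \<open>\<beta>\<close> and the \<open>x\<^sub>i\<close>, the quotient
  \<open>free_alg_on m / idc_ideal m\<close> is \<open>IdC\<^sub>m(\<beta>)[x\<^sub>1, x\<^sub>2, \<dots>]\<close>, with the \<open>x\<^sub>i\<close> commuting with the
  \<open>e\<^sub>j\<close>.
\<close>

inductive_set idc_ideal :: "nat \<Rightarrow> free_alg set" for m :: nat where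
  far: "\<lbrakk>i \<in> {1..<m}; j \<in> {1..<m}; i + 2 \<le> j \<or> j + 2 \<le> i\<rbrakk>
    \<Longrightarrow> gen i * gen j - gen j * gen i \<in> idc_ideal m"
| braid: "\<lbrakk>i \<in> {1..<m}; j \<in> {1..<m}; i + 1 = j \<or> j + 1 = i\<rbrakk>
    \<Longrightarrow> gen i * gen j * gen i - gen j * gen i * gen j \<in> idc_ideal m"
| square: "i \<in> {1..<m} \<Longrightarrow> gen i * gen i - scalar pbeta * gen i \<in> idc_ideal m"
| zero: "0 \<in> idc_ideal m"
| add: "\<lbrakk>p \<in> idc_ideal m; q \<in> idc_ideal m\<rbrakk> \<Longrightarrow> p + q \<in> idc_ideal m"
| left_mult: "\<lbrakk>p \<in> idc_ideal m; c \<in> free_alg_on m\<rbrakk> \<Longrightarrow> c * p \<in> idc_ideal m"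
| right_mult: "\<lbrakk>p \<in> idc_ideal m; c \<in> free_alg_on m\<rbrakk> \<Longrightarrow> p * c \<in> idc_ideal m"

definition perm_of_word :: "nat list \<Rightarrow> nat \<Rightarrow> nat" where
  "perm_of_word u = foldr (\<lambda>i p. Transposition.transpose i (i + 1) \<circ> p) u id"

definition is_word_for :: "nat \<Rightarrow> (nat \<Rightarrow> nat) \<Rightarrow> nat list \<Rightarrow> bool" where
  "is_word_for m w u \<longleftrightarrow> set u \<subseteq> {1..<m} \<and> perm_of_word u = w"

definition reduced_word :: "nat \<Rightarrow> (nat \<Rightarrow> nat) \<Rightarrow> nat list \<Rightarrow> bool" where
  "reduced_word m w u \<longleftrightarrow>
     is_word_for m w u \<and> (\<forall>v. is_word_for m w v \<longrightarrow> length u \<le> length v)"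

text \<open>
  A representative of \<open>e\<^sub>w\<close>. Modulo \<open>idc_ideal m\<close> the choice of the reduced word does not matter,
  because any two reduced words are connected by commutation and braid relations.
\<close>

definition e_perm :: "nat \<Rightarrow> (nat \<Rightarrow> nat) \<Rightarrow> free_alg" where
  "e_perm m w = word_elem (SOME u. reduced_word m w u)"

definition h_factor :: "nat \<Rightarrow> poly \<Rightarrow> free_alg" where
  "h_factor i x = 1 + scalar x * gen i"

definition A_factor :: "nat \<Rightarrow> nat \<Rightarrow> poly \<Rightarrow> free_alg" where
  "A_factor m i x = prod_list (map (\<lambda>j. h_factor j x) (rev [i..<m]))"

definition A_product :: "nat \<Rightarrow> free_alg" where
  "A_product m = prod_list (map (\<lambda>i. A_factor m i (pvar i)) [1..<m])"

text \<open>
  \<open>grothendieck m w\<close> is the coefficient of \<open>e\<^sub>w\<close> in the expansion of \<open>A_product m\<close> in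
  \<open>free_alg_on m / idc_ideal m\<close>. The family of coefficients is unique because the \<open>e\<^sub>w\<close> form a
  basis of the quotient; it is set to 0 outside the symmetric group.
\<close>

definition grothendieck :: "nat \<Rightarrow> (nat \<Rightarrow> nat) \<Rightarrow> poly" where
  "grothendieck m = (THE G.
     (\<forall>w. \<not> w permutes {1..m} \<longrightarrow> G w = 0) \<and>
     A_product m - (\<Sum>w | w permutes {1..m}. scalar (G w) * e_perm m w) \<in> idc_ideal m)"

text \<open>
  \<open>w_perm k n\<close> is the permutation \<open>1\<^sup>k \<times> w\<^sub>0\<close> of \<open>{1..n}\<close>: it fixes \<open>1, \<dots>, k\<close> and sends \<open>k + a\<close>
  to \<open>n + 1 - a\<close> for \<open>1 \<le> a \<le> n - k\<close>.
\<close>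

definition w_perm :: "nat \<Rightarrow> nat \<Rightarrow> nat \<Rightarrow> nat" where
  "w_perm k n j = (if k < j \<and> j \<le> n then n + 1 - (j - k) else j)"

end

theory Submission
  imports Defs
begin

text \<open>
  Write \<open>N = n + k + 1\<close> and \<open>m = n + 1\<close>, and let \<open>R\<close> be the set of relevant diagonals, those with at least
  \<open>k\<close> vertices strictly on each side; all other diagonals form the minimal dissection. The Grothendieck
  polynomial is a sum over certain subsets \<open>P\<close> of \<open>R\<close>. Inverting its variables and multiplying by the
  monomial turns it into a sum over the complements \<open>R - P\<close>, and these are exactly the sets of relevant
  diagonals of the \<open>k\<close>-dissections.

  \<^bold>\<open>Subwords.\<close> The word of letters in \<open>A\<^sub>1(x\<^sub>1) \<cdots> A\<^sub>m\<^sub>-\<^sub>1(x\<^sub>m\<^sub>-\<^sub>1)\<close> is indexed by the pairs \<open>(i, j)\<close> with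
  \<open>1 \<le> i\<close> and \<open>i + k < j \<le> N\<close> in lexicographic order, the pair \<open>(i, j)\<close> carrying the letter \<open>N + i - j\<close>
  and the variable \<open>x\<^sub>i\<close>. The algebra acts from the right on the free module spanned by permutations:
  \<open>e\<^sub>i\<close> sends \<open>w\<close> to \<open>w s\<^sub>i\<close> if \<open>w i < w (i + 1)\<close> and to \<open>\<beta> w\<close> otherwise. A normal form for words, which
  this action separates, shows that the \<open>e\<^sub>w\<close> form a basis and that the coefficient of \<open>e\<^sub>w\<close> can be read
  off from the action on the identity (\<open>grothendieck_eq_act_coeff\<close>). Hence the Grothendieck polynomial
  is a sum over the sets \<open>P\<close> of pairs whose subword takes the identity to \<open>w\<close>; the exponent of \<open>\<beta>\<close> is
  the number of letters that do not act as a swap, that is, the size of \<open>P\<close> minus the number of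
  inversions of \<open>w\<close>.

  \<^bold>\<open>Crossings.\<close> For a threshold \<open>T\<close>, let \<open>C l\<close> be the number of positions \<open>p \<le> l\<close> with \<open>w p > T\<close>. The
  letter \<open>l\<close> replaces \<open>C l\<close> by \<open>min (C (l - 1) + 1) (C (l + 1))\<close> and changes no other value. Let
  \<open>L i j\<close> be \<open>i\<close> minus the value at \<open>N + i - j\<close> once the pair \<open>(i, j)\<close> has been processed. Then \<open>L i j\<close>
  is \<open>L (i - 1) (j - 1) + 1\<close> if \<open>(i, j)\<close> is not in \<open>P\<close> and \<open>max (L (i - 1) j) (L i (j - 1))\<close>
  otherwise, which is the recursion for longest common subsequences. For \<open>T = N - c\<close> the number
  \<open>L c N\<close> therefore exceeds \<open>k\<close> iff the complement of \<open>P\<close> contains \<open>k + 1\<close> pairs, increasing in both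
  coordinates, in \<open>{1..c} \<times> {c<..N}\<close>, and such sets of pairs, for varying \<open>c\<close>, are exactly
  the sets of \<open>k + 1\<close> pairwise crossing diagonals. On the other side, a permutation fixing
  \<open>1, \<dots>, k\<close> is \<open>1\<^sup>k \<times> w\<^sub>0\<close> iff, for all \<open>k < c < m\<close>, the final count \<open>C c\<close> for \<open>T = N - c\<close> has its
  maximal value \<open>c - k\<close>. This count is \<open>c - L c N\<close>, so the condition is \<open>L c N \<le> k\<close>
  (\<open>subword_act_eq_w_perm_iff\<close>).
\<close>


section \<open>Linear functionals on finitely supported functions\<close>

text \<open>
  Both substitution into polynomials and evaluation of the action below have this shape.
\<close>

lemma sum_keys_add:
  fixes g :: "'a \<Rightarrow> 'b::ab_group_add \<Rightarrow> 'c::ab_group_add"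
  assumes g: "\<And>k a b. g k (a + b) = g k a + g k b"
  shows "(\<Sum>k\<in>Poly_Mapping.keys (p + q). g k (Poly_Mapping.lookup (p + q) k)) =
    (\<Sum>k\<in>Poly_Mapping.keys p. g k (Poly_Mapping.lookup p k)) +
    (\<Sum>k\<in>Poly_Mapping.keys q. g k (Poly_Mapping.lookup q k))"
proof -
  define S where "S = Poly_Mapping.keys p \<union> Poly_Mapping.keys q"
  have g0: "g k 0 = 0" for k
    using g[of k 0 0] by simp
  have *: "(\<Sum>k\<in>Poly_Mapping.keys r. g k (Poly_Mapping.lookup r k)) =
      (\<Sum>k\<in>S. g k (Poly_Mapping.lookup r k))" if "Poly_Mapping.keys r \<subseteq> S" for r
    using that by (intro sum.mono_neutral_left) (auto simp: S_def g0 in_keys_iff)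
  have "Poly_Mapping.keys (p + q) \<subseteq> S" "Poly_Mapping.keys p \<subseteq> S" "Poly_Mapping.keys q \<subseteq> S"
    using keys_add[of p q] by (auto simp: S_def)
  then show ?thesis
    by (simp only: *) (simp add: lookup_add g sum.distrib)
qed

lemma poly_mapping_eq_sum_single:
  fixes p :: "'a \<Rightarrow>\<^sub>0 'b::comm_monoid_add"
  shows "p = (\<Sum>k\<in>Poly_Mapping.keys p. Poly_Mapping.single k (Poly_Mapping.lookup p k))"
proof (rule poly_mapping_eqI)
  fix j
  show "Poly_Mapping.lookup p j =
    Poly_Mapping.lookup (\<Sum>k\<in>Poly_Mapping.keys p. Poly_Mapping.single k (Poly_Mapping.lookup p k)) j"
    by (auto simp: lookup_sum lookup_single when_def in_keys_iff sum.If_cases)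
qed

lemma poly_mapping_single_add_induct:
  fixes p :: "'a \<Rightarrow>\<^sub>0 'b::comm_monoid_add"
  assumes "\<And>k a. k \<in> Poly_Mapping.keys p \<Longrightarrow> P (Poly_Mapping.single k a)"
    and "P 0" and "\<And>q r. P q \<Longrightarrow> P r \<Longrightarrow> P (q + r)"
  shows "P p"
proof -
  have "P (\<Sum>k\<in>S. Poly_Mapping.single k (Poly_Mapping.lookup p k))"
    if "finite S" "S \<subseteq> Poly_Mapping.keys p" for S
    using that by (induction S) (auto intro: assms)
  then show ?thesis
    using poly_mapping_eq_sum_single[of p] by (metis finite_keys order_refl)
qed

section \<open>Substitution is a ring homomorphism\<close>

lemma poly_subst_add: "poly_subst v (p + q) = poly_subst v p + poly_subst v q"
  unfolding poly_subst_def by (rule sum_keys_add) (simp add: algebra_simps)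

lemma poly_subst_0 [simp]: "poly_subst v 0 = 0"
  by (simp add: poly_subst_def)

lemma poly_subst_single:
  "poly_subst v (Poly_Mapping.single m c) =
    of_int c * (\<Prod>i\<in>Poly_Mapping.keys m. v i ^ Poly_Mapping.lookup m i)"
  by (simp add: poly_subst_def)

lemma monomial_value_add:
  fixes v :: "nat \<Rightarrow> 'r::comm_ring_1" and m m' :: "nat \<Rightarrow>\<^sub>0 nat"
  shows "(\<Prod>i\<in>Poly_Mapping.keys (m + m'). v i ^ Poly_Mapping.lookup (m + m') i) =
    (\<Prod>i\<in>Poly_Mapping.keys m. v i ^ Poly_Mapping.lookup m i) *
    (\<Prod>i\<in>Poly_Mapping.keys m'. v i ^ Poly_Mapping.lookup m' i)"
proof -
  define S where "S = Poly_Mapping.keys m \<union> Poly_Mapping.keys m'"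
  have *: "(\<Prod>i\<in>Poly_Mapping.keys r. v i ^ Poly_Mapping.lookup r i) =
      (\<Prod>i\<in>S. v i ^ Poly_Mapping.lookup r i)" if "Poly_Mapping.keys r \<subseteq> S" for r
    using that by (intro prod.mono_neutral_left) (auto simp: S_def in_keys_iff)
  have "Poly_Mapping.keys (m + m') \<subseteq> S" "Poly_Mapping.keys m \<subseteq> S" "Poly_Mapping.keys m' \<subseteq> S"
    using keys_add[of m m'] by (auto simp: S_def)
  then show ?thesis
    by (simp only: *) (simp add: lookup_add power_add prod.distrib)
qed

lemma poly_subst_mult: "poly_subst v (p * q) = poly_subst v p * poly_subst v q"
proof (induction p rule: poly_mapping_single_add_induct)
  case (1 k a)
  show ?case
    by (induction q rule: poly_mapping_single_add_induct)
      (simp_all add: mult_single poly_subst_single monomial_value_add poly_subst_add algebra_simps)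
qed (simp_all add: poly_subst_add algebra_simps)

lemma poly_subst_1 [simp]: "poly_subst v 1 = 1"
  using poly_subst_single[of v 0 1] by simp

lemma poly_subst_pvar [simp]: "poly_subst v (pvar i) = v i"
  by (simp add: pvar_def poly_subst_single)

lemma poly_subst_power: "poly_subst v (p ^ n) = poly_subst v p ^ n"
  by (induction n) (simp_all add: poly_subst_mult)

lemma poly_subst_sum: "poly_subst v (\<Sum>x\<in>A. f x) = (\<Sum>x\<in>A. poly_subst v (f x))"
  by (induction A rule: infinite_finite_induct) (simp_all add: poly_subst_add)

lemma poly_subst_prod: "poly_subst v (\<Prod>x\<in>A. f x) = (\<Prod>x\<in>A. poly_subst v (f x))"
  by (induction A rule: infinite_finite_induct) (simp_all add: poly_subst_mult)

section \<open>The right action of words on permutations\<close>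

text \<open>
  One letter \<open>i\<close> of a word acts on \<open>w\<close> from the right: it sorts the positions \<open>i\<close> and \<open>i + 1\<close> into
  decreasing order. Thus \<open>word_act u id\<close> is the Demazure product of the word \<open>u\<close>. The maps are arbitrary
  functions here; if \<open>w i = w (i + 1)\<close>, the letter does nothing.
\<close>

definition sort_step :: "nat \<Rightarrow> (nat \<Rightarrow> nat) \<Rightarrow> nat \<Rightarrow> nat" where
  "sort_step i w = (if w i < w (i + 1) then w \<circ> Transposition.transpose i (i + 1) else w)"

fun word_act :: "nat list \<Rightarrow> (nat \<Rightarrow> nat) \<Rightarrow> nat \<Rightarrow> nat" where
  "word_act [] w = w"
| "word_act (i # u) w = word_act u (sort_step i w)"

text \<open>The number of letters of a word that do not swap anything when the word acts on \<open>w\<close>.\<close>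

fun excess :: "nat list \<Rightarrow> (nat \<Rightarrow> nat) \<Rightarrow> nat" where
  "excess [] w = 0"
| "excess (i # u) w = (if w i < w (i + 1) then 0 else 1) + excess u (sort_step i w)"

lemma word_act_append: "word_act (u @ v) w = word_act v (word_act u w)"
  by (induction u arbitrary: w) auto

lemma excess_append: "excess (u @ v) w = excess u w + excess v (word_act u w)"
  by (induction u arbitrary: w) auto

text \<open>
  A word \<open>u\<close> sends \<open>w\<close> to \<open>\<beta>\<close> to the power \<open>excess u w\<close> times \<open>word_act u w\<close>. This is the
  action of an element of the free algebra on \<open>w\<close>, followed by the linear functional that is given by
  \<open>f\<close> on permutations.
\<close>

definition act_eval :: "(nat \<Rightarrow> nat) \<Rightarrow> ((nat \<Rightarrow> nat) \<Rightarrow> poly) \<Rightarrow> free_alg \<Rightarrow> poly" where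
  "act_eval w f p = (\<Sum>u\<in>Poly_Mapping.keys p. Poly_Mapping.lookup p u *
     (pbeta ^ excess (letters u) w * f (word_act (letters u) w)))"

lemma act_eval_add: "act_eval w f (p + q) = act_eval w f p + act_eval w f q"
  unfolding act_eval_def by (rule sum_keys_add) (simp add: algebra_simps)

lemma act_eval_0 [simp]: "act_eval w f 0 = 0"
  by (simp add: act_eval_def)

lemma act_eval_single:
  "act_eval w f (Poly_Mapping.single u c) =
    c * (pbeta ^ excess (letters u) w * f (word_act (letters u) w))"
  by (simp add: act_eval_def)

lemma act_eval_diff: "act_eval w f (p - q) = act_eval w f p - act_eval w f q"
  using act_eval_add[of w f "p - q" q] by simp

lemma act_eval_sum: "act_eval w f (\<Sum>x\<in>A. g x) = (\<Sum>x\<in>A. act_eval w f (g x))"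
  by (induction A rule: infinite_finite_induct) (simp_all add: act_eval_add)

lemma act_eval_single_mult:
  "act_eval w f (Poly_Mapping.single u c * p) =
    c * pbeta ^ excess (letters u) w * act_eval (word_act (letters u) w) f p"
  by (induction p rule: poly_mapping_single_add_induct)
    (simp_all add: mult_single act_eval_single act_eval_add algebra_simps plus_ncword_def
      word_act_append excess_append power_add)

lemma act_eval_mult_single:
  "act_eval w f (p * Poly_Mapping.single u c) =
    c * act_eval w (\<lambda>z. pbeta ^ excess (letters u) z * f (word_act (letters u) z)) p"
  by (induction p rule: poly_mapping_single_add_induct)
    (simp_all add: mult_single act_eval_single act_eval_add algebra_simps plus_ncword_def
      word_act_append excess_append power_add)

lemma word_elem_append: "word_elem (u @ v) = word_elem u * word_elem v"
  by (simp add: word_elem_def mult_single plus_ncword_def)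

lemma word_elem_Nil [simp]: "word_elem [] = 1"
  by (simp add: word_elem_def flip: zero_ncword_def)

lemma act_eval_scalar_word:
  "act_eval w f (scalar c * word_elem u) = c * (pbeta ^ excess u w * f (word_act u w))"
  by (simp add: scalar_def word_elem_def mult_single act_eval_single)

lemma act_eval_word:
  "act_eval w f (word_elem u) = pbeta ^ excess u w * f (word_act u w)"
  by (simp add: word_elem_def act_eval_single)

lemma sort_step_far:
  assumes "i + 2 \<le> j \<or> j + 2 \<le> i"
  shows "word_act [i, j] w = word_act [j, i] w" "excess [i, j] w = excess [j, i] w"
proof -
  let ?s = "Transposition.transpose i (i + 1)" and ?t = "Transposition.transpose j (j + 1)"
  have s: "?s j = j" "?s (j + 1) = j + 1" and t: "?t i = i" "?t (i + 1) = i + 1"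
    using assms by (auto simp: Transposition.transpose_def)
  have st: "?s \<circ> ?t = ?t \<circ> ?s"
    using transpose_comp_eq[of ?s j "j + 1"] s by simp
  have "word_act [i, j] w = word_act [j, i] w \<and> excess [i, j] w = excess [j, i] w"
    by (cases "w i < w (i + 1)"; cases "w j < w (j + 1)")
      (simp_all only: word_act.simps excess.simps sort_step_def o_apply s t if_True if_False
        o_assoc[symmetric] simp_thms st)
  then show "word_act [i, j] w = word_act [j, i] w" "excess [i, j] w = excess [j, i] w"
    by blast+
qed

lemma sort_step_braid:
  "word_act [i, i + 1, i] w = word_act [i + 1, i, i + 1] w"
  "excess [i, i + 1, i] w = excess [i + 1, i, i + 1] w"
proof -
  let ?s = "Transposition.transpose i (i + 1)" and ?t = "Transposition.transpose (i + 1) (i + 2)"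
  have s: "?s i = i + 1" "?s (i + 1) = i" "?s (i + 2) = i + 2"
    and t: "?t i = i" "?t (i + 1) = i + 2" "?t (i + 2) = i + 1"
    by (simp_all add: Transposition.transpose_def)
  have st: "?s \<circ> (?t \<circ> ?s) = ?t \<circ> (?s \<circ> ?t)"
    using transpose_comp_triple[of i "i + 2" "i + 1"] transpose_comp_triple[of "i + 2" i "i + 1"]
    by (simp add: transpose_commute comp_assoc)
  consider "w i < w (i + 1)" "w (i + 1) < w (i + 2)" "w i < w (i + 2)"
    | "w i < w (i + 1)" "\<not> w (i + 1) < w (i + 2)" "w i < w (i + 2)"
    | "w i < w (i + 1)" "\<not> w (i + 1) < w (i + 2)" "\<not> w i < w (i + 2)"
    | "\<not> w i < w (i + 1)" "w (i + 1) < w (i + 2)" "w i < w (i + 2)"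
    | "\<not> w i < w (i + 1)" "w (i + 1) < w (i + 2)" "\<not> w i < w (i + 2)"
    | "\<not> w i < w (i + 1)" "\<not> w (i + 1) < w (i + 2)" "\<not> w i < w (i + 2)"
    by linarith
  then have "word_act [i, i + 1, i] w = word_act [i + 1, i, i + 1] w \<and>
      excess [i, i + 1, i] w = excess [i + 1, i, i + 1] w"
    by cases (insert st, simp_all only: word_act.simps excess.simps sort_step_def add.assoc
        one_add_one o_apply s t if_True if_False o_assoc[symmetric] simp_thms not_less, auto)
  then show "word_act [i, i + 1, i] w = word_act [i + 1, i, i + 1] w"
    "excess [i, i + 1, i] w = excess [i + 1, i, i + 1] w"
    by blast+
qed

lemma sort_step_square:
  "word_act [i, i] w = word_act [i] w" "excess [i, i] w = Suc (excess [i] w)"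
  by (auto simp: sort_step_def fun_eq_iff Transposition.transpose_def)

text \<open>
  The relations hold for the action, so it descends to the quotient. The statement for all \<open>w\<close> and \<open>f\<close>
  at once is what makes it stable under multiplication on either side.
\<close>

lemma act_eval_ideal:
  assumes "p \<in> idc_ideal m"
  shows "act_eval w f p = 0"
  using assms
proof (induction arbitrary: w f)
  case (far i j)
  then show ?case
    by (simp only: word_elem_append[symmetric] act_eval_diff act_eval_word append_Cons append_Nil
      sort_step_far[OF far(3)]) simp
next
  case (braid i j)
  then show ?case
    using sort_step_braid[of i w] sort_step_braid[of j w]
    by (simp only: word_elem_append[symmetric] act_eval_diff act_eval_word append_Cons append_Nil) auto
next
  case (square i)
  show ?case
    by (simp only: word_elem_append[symmetric] act_eval_diff act_eval_word append_Cons append_Nil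
      act_eval_scalar_word sort_step_square) (simp add: algebra_simps)
next
  case (left_mult p c)
  show ?case
    by (induction c rule: poly_mapping_single_add_induct)
      (simp_all add: act_eval_single_mult left_mult.IH act_eval_add distrib_right)
next
  case (right_mult p c)
  show ?case
    by (induction c rule: poly_mapping_single_add_induct)
      (simp_all add: act_eval_mult_single right_mult.IH act_eval_add distrib_left)
qed (simp_all add: act_eval_add)

section \<open>Reduced words\<close>

lemma perm_of_word_append: "perm_of_word (u @ v) = perm_of_word u \<circ> perm_of_word v"
  by (induction u) (auto simp: perm_of_word_def fun_eq_iff)

lemma perm_of_word_Nil [simp]: "perm_of_word [] = id"
  by (simp add: perm_of_word_def)

lemma perm_of_word_single [simp]: "perm_of_word [i] = Transposition.transpose i (i + 1)"
  by (simp add: perm_of_word_def)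

lemma perm_of_word_permutes:
  "set u \<subseteq> {1..<m} \<Longrightarrow> perm_of_word u permutes {1..m}"
proof (induction u)
  case (Cons i u)
  then have "Transposition.transpose i (i + 1) permutes {1..m}"
    by (intro permutes_swap_id) auto
  with Cons show ?case
    using perm_of_word_append[of "[i]" u] permutes_compose[of "perm_of_word u"]
    by (simp del: o_apply)
qed (simp add: permutes_id)

text \<open>
  The exchange property: values in the wrong order were swapped by some letter of the word, and deleting
  that letter undoes the swap. The positions are not assumed to be adjacent, because the induction
  conjugates the transposition by the last letter.
\<close>

lemma exchange:
  assumes "p < q" "perm_of_word u p > perm_of_word u q"
  shows "\<exists>v. set v \<subseteq> set u \<and> length v < length u \<and>
    perm_of_word v = perm_of_word u \<circ> Transposition.transpose p q"
  using assms
proof (induction u arbitrary: p q rule: rev_induct)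
  case (snoc j u)
  let ?s = "Transposition.transpose j (j + 1)"
  have pu: "perm_of_word (u @ [j]) = perm_of_word u \<circ> ?s"
    by (simp add: perm_of_word_append)
  show ?case
  proof (cases "?s p < ?s q")
    case True
    then obtain v where v: "set v \<subseteq> set u" "length v < length u"
      "perm_of_word v = perm_of_word u \<circ> Transposition.transpose (?s p) (?s q)"
      using snoc.IH[OF True] snoc.prems(2) unfolding pu o_apply by blast
    have "perm_of_word (v @ [j]) = perm_of_word (u @ [j]) \<circ> Transposition.transpose p q"
      using transpose_comp_eq[of ?s "?s p" "?s q"]
      unfolding perm_of_word_append v(3) perm_of_word_single
      by (simp add: comp_assoc)
    moreover have "set (v @ [j]) \<subseteq> set (u @ [j])" "length (v @ [j]) < length (u @ [j])"
      using v(1,2) by auto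
    ultimately show ?thesis
      by blast
  next
    case False
    have "p = j \<and> q = j + 1"
    proof (rule ccontr)
      assume "\<not> (p = j \<and> q = j + 1)"
      with snoc.prems(1) have "?s p < ?s q"
        unfolding Transposition.transpose_def by (cases "p = j"; cases "q = j"; cases "p = j + 1"; cases "q = j + 1") simp_all
      with False show False ..
    qed
    then have "perm_of_word u = perm_of_word (u @ [j]) \<circ> Transposition.transpose p q"
      by (simp only: pu comp_assoc transpose_comp_involutory comp_id)
    then show ?thesis
      by (intro exI[of _ u]) (simp only: set_append length_append, auto)
  qed
qed simp

text \<open>Every letter of a reduced word swaps an ascent, for otherwise the exchange property shortens it.\<close>

lemma reduced_word_act:
  assumes "reduced_word m w u"
  shows "word_act u id = w \<and> excess u id = 0"
  using assms
proof (induction u arbitrary: w rule: rev_induct)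
  case Nil
  then show ?case
    by (auto simp: reduced_word_def is_word_for_def)
next
  case (snoc i u)
  let ?p = "perm_of_word u"
  have w: "w = ?p \<circ> Transposition.transpose i (i + 1)" and sub: "set u \<subseteq> {1..<m}" "i \<in> {1..<m}"
    and min: "\<And>v. is_word_for m w v \<Longrightarrow> length (u @ [i]) \<le> length v"
    using snoc.prems unfolding reduced_word_def is_word_for_def perm_of_word_append
      perm_of_word_single by simp_all
  have "reduced_word m ?p u"
    unfolding reduced_word_def
  proof (intro conjI allI impI)
    show "is_word_for m ?p u"
      using sub by (simp add: is_word_for_def)
    fix v
    assume "is_word_for m ?p v"
    then have "is_word_for m w (v @ [i])"
      using sub w by (simp add: is_word_for_def perm_of_word_append)
    from min[OF this] show "length u \<le> length v"
      by simp
  qed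
  then have IH: "word_act u id = ?p" "excess u id = 0"
    using snoc.IH by blast+
  have "\<not> ?p i > ?p (i + 1)"
  proof
    assume "?p i > ?p (i + 1)"
    then obtain v where "set v \<subseteq> set u" "length v < length u" "perm_of_word v = w"
      using exchange[of i "i + 1" u] unfolding w by auto
    with min[of v] sub show False
      by (auto simp: is_word_for_def)
  qed
  moreover have "?p i \<noteq> ?p (i + 1)"
    using injD[OF permutes_inj[OF perm_of_word_permutes[OF sub(1)]], of i "i + 1"] by linarith
  ultimately have "?p i < ?p (i + 1)"
    by simp
  then show ?case
    by (simp only: word_act_append excess_append IH word_act.simps excess.simps sort_step_def w if_True
      simp_thms add_0)
qed

lemma transpose_word:
  assumes "1 \<le> a" "a < b" "b \<le> m"
  shows "\<exists>u. set u \<subseteq> {1..<m} \<and> perm_of_word u = Transposition.transpose a b"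
proof -
  have "b \<le> m \<longrightarrow> (\<exists>u. set u \<subseteq> {1..<m} \<and> perm_of_word u = Transposition.transpose a b)"
    using Suc_leI[OF assms(2)]
  proof (induction b rule: dec_induct)
    case base
    show ?case
      using assms(1) by (auto intro!: exI[of _ "[a]"])
  next
    case (step b)
    show ?case
    proof
      assume "Suc b \<le> m"
      with step obtain u where u: "set u \<subseteq> {1..<m}" "perm_of_word u = Transposition.transpose a b"
        by auto
      have "perm_of_word ([b] @ u @ [b]) = Transposition.transpose a (Suc b)"
        using transpose_comp_triple[of "Suc b" a b] step.hyps
        unfolding perm_of_word_append u perm_of_word_single
        by (simp add: transpose_commute comp_assoc)
      then show "\<exists>u. set u \<subseteq> {1..<m} \<and> perm_of_word u = Transposition.transpose a (Suc b)"
        using u step.hyps assms(1) \<open>Suc b \<le> m\<close> by (intro exI[of _ "[b] @ u @ [b]"]) auto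
    qed
  qed
  then show ?thesis
    using assms by blast
qed

lemma permutes_word:
  assumes "w permutes {1..m}"
  shows "\<exists>u. is_word_for m w u"
  using assms finite_atLeastAtMost
proof (induction rule: permutes_induct)
  case id
  show ?case
    by (intro exI[of _ "[]"]) (simp add: is_word_for_def id_def)
next
  case (swap a b p)
  obtain v where v: "is_word_for m p v"
    using swap.IH by blast
  have "\<exists>u. set u \<subseteq> {1..<m} \<and> perm_of_word u = Transposition.transpose a b"
    using transpose_word[of a b m] transpose_word[of b a m] swap(1-3)
    by (cases a b rule: linorder_cases) (auto simp: transpose_commute)
  then obtain u where "set u \<subseteq> {1..<m}" "perm_of_word u = Transposition.transpose a b"
    by blast
  with v show ?case
    by (intro exI[of _ "u @ v"]) (auto simp: is_word_for_def perm_of_word_append)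
qed

lemma permutes_reduced_word:
  assumes "w permutes {1..m}"
  shows "\<exists>u. reduced_word m w u"
  using ex_has_least_nat[of "is_word_for m w" _ length] permutes_word[OF assms]
  unfolding reduced_word_def by blast

lemma e_perm_word:
  assumes "w permutes {1..m}"
  obtains u where "e_perm m w = word_elem u" "set u \<subseteq> {1..<m}" "word_act u id = w" "excess u id = 0"
proof
  let ?u = "SOME u. reduced_word m w u"
  have *: "reduced_word m w ?u"
    using permutes_reduced_word[OF assms] by (rule someI_ex)
  show "e_perm m w = word_elem ?u"
    by (simp add: e_perm_def)
  show "set ?u \<subseteq> {1..<m}" "word_act ?u id = w" "excess ?u id = 0"
    using reduced_word_act[OF *] * by (auto simp: reduced_word_def is_word_for_def)
qed

section \<open>Straightening words modulo the relations\<close>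

lemma scalar_1 [simp]: "scalar 1 = 1"
  by (simp add: scalar_def)

lemma scalar_0 [simp]: "scalar 0 = 0"
  by (simp add: scalar_def)

lemma scalar_mult: "scalar (c * d) = scalar c * scalar d"
  by (simp add: scalar_def mult_single)

lemma scalar_add: "scalar (c + d) = scalar c + scalar d"
  by (simp add: scalar_def single_add)

lemma scalar_commute: "p * scalar c = scalar c * p"
  by (induction p rule: poly_mapping_single_add_induct)
    (simp_all add: scalar_def mult_single mult.commute distrib_left distrib_right)

lemma single_eq_scalar_word: "Poly_Mapping.single u c = scalar c * word_elem (letters u)"
  by (simp add: scalar_def word_elem_def mult_single)

lemma free_alg_on_single:
  "set (letters u) \<subseteq> {1..<m} \<Longrightarrow> Poly_Mapping.single u c \<in> free_alg_on m"
  by (auto simp: free_alg_on_def)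

lemma scalar_in_free_alg_on [simp]: "scalar c \<in> free_alg_on m"
  unfolding scalar_def by (rule free_alg_on_single) (simp add: zero_ncword_def)

lemma word_in_free_alg_on: "set u \<subseteq> {1..<m} \<Longrightarrow> word_elem u \<in> free_alg_on m"
  unfolding word_elem_def by (rule free_alg_on_single) simp

lemma free_alg_on_add: "p \<in> free_alg_on m \<Longrightarrow> q \<in> free_alg_on m \<Longrightarrow> p + q \<in> free_alg_on m"
  using keys_add[of p q] by (auto simp: free_alg_on_def)

lemma free_alg_on_mult: "p \<in> free_alg_on m \<Longrightarrow> q \<in> free_alg_on m \<Longrightarrow> p * q \<in> free_alg_on m"
  using keys_mult[of p q] by (fastforce simp: free_alg_on_def plus_ncword_def)

lemma one_in_free_alg_on [simp]: "1 \<in> free_alg_on m"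
  using scalar_in_free_alg_on[of 1 m] by simp

lemma free_alg_on_prod_list:
  "(\<And>p. p \<in> set ps \<Longrightarrow> p \<in> free_alg_on m) \<Longrightarrow> prod_list ps \<in> free_alg_on m"
  by (induction ps) (auto intro: free_alg_on_mult)

lemma idc_ideal_scalar: "p \<in> idc_ideal m \<Longrightarrow> scalar c * p \<in> idc_ideal m"
  by (rule idc_ideal.left_mult) simp_all

lemma idc_ideal_uminus: "p \<in> idc_ideal m \<Longrightarrow> - p \<in> idc_ideal m"
  using idc_ideal_scalar[of p m "- 1"] by (simp add: scalar_def single_uminus)

text \<open>The word \<open>u\<close> equals \<open>\<beta>\<close> to the power \<open>a\<close> times the word \<open>v\<close> in the quotient algebra.\<close>

definition straightens :: "nat \<Rightarrow> nat list \<Rightarrow> nat \<Rightarrow> nat list \<Rightarrow> bool" where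
  "straightens m u a v \<longleftrightarrow> word_elem u - scalar (pbeta ^ a) * word_elem v \<in> idc_ideal m"

lemma straightens_refl: "straightens m u 0 u"
  by (simp add: straightens_def idc_ideal.zero)

lemma straightens_trans:
  assumes "straightens m u a v" "straightens m v b w"
  shows "straightens m u (a + b) w"
proof -
  have "word_elem u - scalar (pbeta ^ (a + b)) * word_elem w =
    (word_elem u - scalar (pbeta ^ a) * word_elem v) +
    scalar (pbeta ^ a) * (word_elem v - scalar (pbeta ^ b) * word_elem w)"
    by (simp add: algebra_simps power_add scalar_mult)
  with idc_ideal.add[OF assms(1)[unfolded straightens_def]
      idc_ideal_scalar[OF assms(2)[unfolded straightens_def], of "pbeta ^ a"]]
  show ?thesis
    unfolding straightens_def by metis
qed

lemma straightens_sym: "straightens m u 0 v \<Longrightarrow> straightens m v 0 u"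
  unfolding straightens_def using idc_ideal_uminus by fastforce

lemma straightens_context:
  assumes "straightens m u a v" "set x \<subseteq> {1..<m}" "set y \<subseteq> {1..<m}"
  shows "straightens m (x @ u @ y) a (x @ v @ y)"
proof -
  have "word_elem (x @ u @ y) - scalar (pbeta ^ a) * word_elem (x @ v @ y) =
    word_elem x * ((word_elem u - scalar (pbeta ^ a) * word_elem v) * word_elem y)"
    unfolding word_elem_append
    by (simp add: algebra_simps) (metis mult.assoc scalar_commute)
  then show ?thesis
    using assms unfolding straightens_def
    by (simp add: idc_ideal.left_mult idc_ideal.right_mult word_in_free_alg_on)
qed

lemma straightens_append_right:
  "straightens m u a v \<Longrightarrow> set y \<subseteq> {1..<m} \<Longrightarrow> straightens m (u @ y) a (v @ y)"
  using straightens_context[of m u a v "[]" y] by simp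

lemma straightens_append_left:
  "straightens m u a v \<Longrightarrow> set x \<subseteq> {1..<m} \<Longrightarrow> straightens m (x @ u) a (x @ v)"
  using straightens_context[of m u a v x "[]"] by simp

lemma straightens_far:
  "i \<in> {1..<m} \<Longrightarrow> j \<in> {1..<m} \<Longrightarrow> i + 2 \<le> j \<or> j + 2 \<le> i \<Longrightarrow> straightens m [i, j] 0 [j, i]"
  unfolding straightens_def using idc_ideal.far[of i m j] word_elem_append[of "[i]" "[j]"]
    word_elem_append[of "[j]" "[i]"] by simp

lemma straightens_braid:
  assumes "i \<in> {1..<m}" "j \<in> {1..<m}" "i + 1 = j \<or> j + 1 = i"
  shows "straightens m [i, j, i] 0 [j, i, j]"
  unfolding straightens_def using idc_ideal.braid[OF assms] word_elem_append[of "[i]" "[j, i]"]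
    word_elem_append[of "[j]" "[i, j]"] word_elem_append[of "[i]" "[j]"]
    word_elem_append[of "[j]" "[i]"]
  by (simp add: mult.assoc)

lemma straightens_square: "i \<in> {1..<m} \<Longrightarrow> straightens m [i, i] 1 [i]"
  unfolding straightens_def using idc_ideal.square[of i m] word_elem_append[of "[i]" "[i]"] by simp

lemma straightens_commute:
  assumes "i \<in> {1..<m}" "set u \<subseteq> {1..<m}" "\<And>j. j \<in> set u \<Longrightarrow> i + 2 \<le> j \<or> j + 2 \<le> i"
  shows "straightens m (u @ [i]) 0 (i # u)"
  using assms(2,3)
proof (induction u)
  case (Cons j u)
  have 1: "straightens m ([j] @ (u @ [i])) 0 ([j] @ (i # u))"
    using Cons by (intro straightens_append_left) auto
  have "straightens m ([j, i] @ u) 0 ([i, j] @ u)"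
    using Cons assms(1) by (intro straightens_append_right straightens_far) auto
  with 1 show ?case
    using straightens_trans[OF 1, of 0] by simp
qed (simp add: straightens_refl)

text \<open>The descending word \<open>M, M - 1, \<dots>, p\<close>, which is empty for \<open>p = M + 1\<close>.\<close>

definition desc_run :: "nat \<Rightarrow> nat \<Rightarrow> nat list" where
  "desc_run M p = rev [p..<Suc M]"

lemma desc_run_snoc: "p \<le> M \<Longrightarrow> desc_run M p = desc_run M (Suc p) @ [p]"
  by (simp add: desc_run_def upt_conv_Cons del: upt_Suc)

lemma set_desc_run [simp]: "set (desc_run M p) = {p..M}"
  by (auto simp: desc_run_def)

lemma desc_run_empty [simp]: "desc_run M (Suc M) = []"
  by (simp add: desc_run_def)

lemma desc_run_split: "p \<le> q \<Longrightarrow> q \<le> Suc M \<Longrightarrow> desc_run M p = desc_run M q @ rev [p..<q]"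
  unfolding desc_run_def rev_append[symmetric]
  by (metis le_add_diff_inverse upt_add_eq_append)

text \<open>
  A letter to the right of a run is absorbed by it or moves to its left as a letter smaller than \<open>M\<close>.
\<close>

lemma straightens_desc_run_letter:
  assumes m: "{1..M} \<subseteq> {1..<m}" and p: "1 \<le> p" "p \<le> Suc M" and i: "1 \<le> i" "i \<le> M"
  shows "\<exists>a x q. set x \<subseteq> {1..<M} \<and> 1 \<le> q \<and> q \<le> Suc M \<and>
    straightens m (desc_run M p @ [i]) a (x @ desc_run M q)"
proof -
  have range: "{j..M} \<subseteq> {1..<m}" if "1 \<le> j" for j
    using m that by (meson atLeastatMost_subset_iff order_refl order_trans)
  have im: "i \<in> {1..<m}"
    using m i by auto
  consider "i + 1 < p" | "i + 1 = p" | "i = p" | "p < i"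
    by linarith
  then show ?thesis
  proof cases
    case 1
    then have "straightens m (desc_run M p @ [i]) 0 ([i] @ desc_run M p)"
      using straightens_commute[of i m "desc_run M p"] im range p by force
    then show ?thesis
      using 1 p i by (intro exI[of _ 0] exI[of _ "[i]"] exI[of _ p]) auto
  next
    case 2
    then have "desc_run M p @ [i] = [] @ desc_run M i"
      using i desc_run_snoc[of i M] by simp
    then show ?thesis
      using i straightens_refl[of m "desc_run M i"]
      by (intro exI[of _ 0] exI[of _ "[]"] exI[of _ i]) simp
  next
    case 3
    have "straightens m (desc_run M (Suc i) @ [i, i]) 1 (desc_run M (Suc i) @ [i])"
      using im range[of "Suc i"] by (intro straightens_append_left straightens_square) auto
    then have "straightens m (desc_run M p @ [i]) 1 ([] @ desc_run M p)"
      using 3 i desc_run_snoc[of i M] by simp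
    then show ?thesis
      using p by (intro exI[of _ 1] exI[of _ "[]"] exI[of _ p]) simp
  next
    case 4
    define j where "j = i - 1"
    have j: "i = Suc j" "p \<le> j" "1 \<le> j"
      using 4 p by (auto simp: j_def)
    have jm: "j \<in> {1..<m}"
      using im j by auto
    let ?l = "desc_run M (Suc i)" and ?r = "rev [p..<j]"
    have run: "desc_run M p = ?l @ [i, j] @ ?r"
      using desc_run_split[of p j M] desc_run_snoc[of j M] desc_run_snoc[of i M] i j by simp
    have l: "set ?l \<subseteq> {1..<m}"
      using range[of "Suc i"] by simp
    have "set ?r \<subseteq> {p..M}"
      using i j by auto
    then have r: "set ?r \<subseteq> {1..<m}"
      using range[of p] p by blast
    have "straightens m (?r @ [i]) 0 (i # ?r)"
      using im r j by (intro straightens_commute) auto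
    then have 1: "straightens m ((?l @ [i, j]) @ (?r @ [i])) 0 ((?l @ [i, j]) @ (i # ?r))"
      using l im jm by (intro straightens_append_left) auto
    have 2: "straightens m (?l @ [i, j, i] @ ?r) 0 (?l @ [j, i, j] @ ?r)"
      using im jm l r j by (intro straightens_context straightens_braid) auto
    have "straightens m (?l @ [j]) 0 (j # ?l)"
      using jm l j by (intro straightens_commute) auto
    then have 3: "straightens m ((?l @ [j]) @ ([i, j] @ ?r)) 0 ((j # ?l) @ ([i, j] @ ?r))"
      using r im jm by (intro straightens_append_right) auto
    from 1 have 1: "straightens m (desc_run M p @ [i]) 0 (?l @ [i, j, i] @ ?r)"
      by (simp add: run)
    from 3 have 3: "straightens m (?l @ [j, i, j] @ ?r) 0 ([j] @ desc_run M p)"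
      by (simp add: run)
    have "straightens m (desc_run M p @ [i]) 0 ([j] @ desc_run M p)"
      using straightens_trans[OF straightens_trans[OF 1 2] 3] by simp
    then show ?thesis
      using p i j by (intro exI[of _ 0] exI[of _ "[j]"] exI[of _ p]) auto
  qed
qed

text \<open>
  Normal forms over the letters \<open>1, \<dots>, M\<close>: one descending run, possibly empty, from each letter, in
  increasing order of the starting letters.
\<close>

fun normal_words :: "nat \<Rightarrow> nat list set" where
  "normal_words 0 = {[]}"
| "normal_words (Suc M) = {u @ desc_run (Suc M) p | u p. u \<in> normal_words M \<and> 1 \<le> p \<and> p \<le> Suc (Suc M)}"

lemma straightens_last_run:
  assumes m: "{1..M} \<subseteq> {1..<m}" and u: "set u \<subseteq> {1..M}"
  shows "\<exists>a x p. set x \<subseteq> {1..<M} \<and> 1 \<le> p \<and> p \<le> Suc M \<and> straightens m u a (x @ desc_run M p)"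
  using u
proof (induction u rule: rev_induct)
  case Nil
  show ?case
    using straightens_refl[of m "[]"]
    by (intro exI[of _ 0] exI[of _ "[]"] exI[of _ "Suc M"]) simp
next
  case (snoc i u)
  then obtain a x p where x: "set x \<subseteq> {1..<M}" "1 \<le> p" "p \<le> Suc M"
    "straightens m u a (x @ desc_run M p)"
    by auto
  obtain b y q where y: "set y \<subseteq> {1..<M}" "1 \<le> q" "q \<le> Suc M"
    "straightens m (desc_run M p @ [i]) b (y @ desc_run M q)"
    using straightens_desc_run_letter[OF m x(2,3), of i] snoc.prems by auto
  have xm: "set x \<subseteq> {1..<m}" and im: "set [i] \<subseteq> {1..<m}"
    using subset_trans[OF _ m, of "set x"] subset_trans[OF _ m, of "set [i]"] x(1) snoc.prems
    by force+
  have "straightens m (u @ [i]) a ((x @ desc_run M p) @ [i])"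
    by (rule straightens_append_right[OF x(4) im])
  moreover have "straightens m (x @ (desc_run M p @ [i])) b (x @ (y @ desc_run M q))"
    by (rule straightens_append_left[OF y(4) xm])
  ultimately have "straightens m (u @ [i]) (a + b) ((x @ y) @ desc_run M q)"
    using straightens_trans by simp
  then show ?case
    using x(1) y(1-3) by (intro exI[of _ "a + b"] exI[of _ "x @ y"] exI[of _ q]) simp
qed

lemma straightens_normal_word:
  assumes "{1..M} \<subseteq> {1..<m}" "set u \<subseteq> {1..M}"
  shows "\<exists>a. \<exists>v\<in>normal_words M. straightens m u a v"
  using assms
proof (induction M arbitrary: u)
  case 0
  then show ?case
    using straightens_refl[of m "[]"] by auto
next
  case (Suc M)
  obtain a x p where x: "set x \<subseteq> {1..<Suc M}" "1 \<le> p" "p \<le> Suc (Suc M)"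
    "straightens m u a (x @ desc_run (Suc M) p)"
    using straightens_last_run[OF Suc.prems] by blast
  obtain b v where v: "v \<in> normal_words M" "straightens m x b v"
    using Suc.IH[of x] x(1) Suc.prems(1) by fastforce
  have "straightens m (x @ desc_run (Suc M) p) b (v @ desc_run (Suc M) p)"
    using Suc.prems(1) x(2) by (intro straightens_append_right v) (force dest: subsetD)
  from straightens_trans[OF x(4) this] show ?case
    using v x by (intro exI[of _ "a + b"] bexI[of _ "v @ desc_run (Suc M) p"]) auto
qed

lemma sort_step_permutes:
  assumes "w permutes {1..m}" "i \<in> {1..<m}"
  shows "sort_step i w permutes {1..m}"
  using permutes_compose[OF permutes_swap_id[of i "{1..m}" "i + 1"] assms(1)] assms
  unfolding sort_step_def by (simp del: One_nat_def o_apply)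

lemma word_act_permutes:
  "w permutes {1..m} \<Longrightarrow> set u \<subseteq> {1..<m} \<Longrightarrow> word_act u w permutes {1..m}"
  by (induction u arbitrary: w) (simp_all add: sort_step_permutes del: One_nat_def)

text \<open>
  Acting on a permutation of \<open>{1..M}\<close>, a run moves the value \<open>M + 1\<close> to position \<open>p\<close> by swaps only.
\<close>

lemma desc_run_act:
  assumes w: "w permutes {1..M}" and p: "1 \<le> p" "p \<le> Suc M"
  shows "excess (desc_run M p) w = 0 \<and> word_act (desc_run M p) w =
    (\<lambda>x. if x = p then Suc M else if p < x \<and> x \<le> Suc M then w (x - 1) else w x)"
  using p(2,1)
proof (induction p rule: inc_induct)
  case base
  show ?case
    using permutes_not_in[OF w, of "Suc M"] by (auto simp: fun_eq_iff)
next
  case (step p)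
  let ?z = "word_act (desc_run M (Suc p)) w"
  have z: "excess (desc_run M (Suc p)) w = 0" "?z =
    (\<lambda>x. if x = Suc p then Suc M else if Suc p < x \<and> x \<le> Suc M then w (x - 1) else w x)"
    using step.IH by simp_all
  have "w p \<in> {1..M}"
    using step permutes_in_image[OF w, of p] by auto
  then have lt: "?z p < ?z (p + 1)"
    by (simp add: z(2))
  have "?z \<circ> Transposition.transpose p (p + 1) =
    (\<lambda>x. if x = p then Suc M else if p < x \<and> x \<le> Suc M then w (x - 1) else w x)"
    using step.hyps by (auto simp: fun_eq_iff z(2) Transposition.transpose_def)
  then show ?case
    using step.hyps lt z(1) desc_run_snoc[of p M]
    by (simp add: word_act_append excess_append sort_step_def)
qed

lemma normal_word_act:
  assumes "u \<in> normal_words M"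
  shows "excess u id = 0 \<and> word_act u id permutes {1..Suc M}"
  using assms
proof (induction M arbitrary: u)
  case 0
  then show ?case
    using permutes_id[of "{1..Suc 0}"] by (simp only: normal_words.simps singleton_iff
      excess.simps word_act.simps simp_thms)
next
  case (Suc M)
  then obtain v p where v: "u = v @ desc_run (Suc M) p" "v \<in> normal_words M" "1 \<le> p" "p \<le> Suc (Suc M)"
    by auto
  have "word_act v id permutes {1..Suc (Suc M)}"
    by (rule permutes_subset[OF conjunct2[OF Suc.IH[OF v(2)]]]) auto
  then have "word_act u id permutes {1..Suc (Suc M)}"
    unfolding v(1) word_act_append by (rule word_act_permutes) (use v(3) in auto)
  then show ?case
    using Suc.IH[OF v(2)] desc_run_act[OF _ v(3,4), of "word_act v id"]
    unfolding v(1) excess_append by blast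
qed

text \<open>
  Different normal forms have different permutations: the position of the largest value determines the
  last run. Together with straightening this replaces the connectedness of the reduced words of
  a permutation under braid moves.
\<close>

lemma normal_word_act_inj:
  assumes "u \<in> normal_words M" "v \<in> normal_words M" "word_act u id = word_act v id"
  shows "u = v"
  using assms
proof (induction M arbitrary: u v)
  case (Suc M)
  obtain u' p where u: "u = u' @ desc_run (Suc M) p" "u' \<in> normal_words M" "1 \<le> p" "p \<le> Suc (Suc M)"
    using Suc.prems(1) by auto
  obtain v' q where v: "v = v' @ desc_run (Suc M) q" "v' \<in> normal_words M" "1 \<le> q" "q \<le> Suc (Suc M)"
    using Suc.prems(2) by auto
  let ?x = "word_act u' id" and ?y = "word_act v' id"
  have x: "?x permutes {1..Suc M}" and y: "?y permutes {1..Suc M}"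
    using normal_word_act u(2) v(2) by blast+
  have eq: "(\<lambda>r. if r = p then Suc (Suc M) else if p < r \<and> r \<le> Suc (Suc M) then ?x (r - 1) else ?x r) =
    (\<lambda>r. if r = q then Suc (Suc M) else if q < r \<and> r \<le> Suc (Suc M) then ?y (r - 1) else ?y r)"
    using Suc.prems(3) desc_run_act[OF x u(3,4)] desc_run_act[OF y v(3,4)]
    unfolding u(1) v(1) word_act_append by metis
  have y_bound: "?y r \<noteq> Suc (Suc M)" if "r \<le> Suc M" for r
    using permutes_in_image[OF y, of r] permutes_not_in[OF y, of r] that
    by (cases "r \<in> {1..Suc M}") auto
  have pq: "p = q"
  proof (rule ccontr)
    assume "p \<noteq> q"
    then consider "q < p" | "p < q"
      by linarith
    then show False
    proof cases
      case 1
      then have "?y (p - 1) = Suc (Suc M)"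
        using fun_cong[OF eq, of p] u(4) by simp
      with y_bound[of "p - 1"] u(4) show False
        by linarith
    next
      case 2
      then have "?y p = Suc (Suc M)"
        using fun_cong[OF eq, of p] by simp
      with y_bound[of p] 2 v(4) show False
        by linarith
    qed
  qed
  have "?x = ?y"
  proof
    fix r
    consider "r < p" | "p \<le> r" "r \<le> Suc M" | "r > Suc M"
      by linarith
    then show "?x r = ?y r"
    proof cases
      case 1
      then show ?thesis
        using fun_cong[OF eq, of r] pq by simp
    next
      case 2
      then show ?thesis
        using fun_cong[OF eq, of "Suc r"] pq by simp
    next
      case 3
      then show ?thesis
        using permutes_not_in[OF x, of r] permutes_not_in[OF y, of r] by simp
    qed
  qed
  then show ?case
    using Suc.IH u v pq by blast
qed simp

section \<open>The Grothendieck polynomial as a coefficient of the action\<close>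

lemma pvar_power: "pvar i ^ a = Poly_Mapping.single (Poly_Mapping.single i a) 1"
  by (induction a) (simp_all add: pvar_def mult_single flip: single_add)

lemma pvar_power_inj:
  assumes "pvar i ^ a = pvar i ^ b"
  shows "a = b"
proof -
  have "Poly_Mapping.keys (pvar i ^ a) = Poly_Mapping.keys (pvar i ^ b)"
    by (simp only: assms)
  then have "Poly_Mapping.single i a = Poly_Mapping.single i b"
    by (simp add: pvar_power)
  then show ?thesis
    by (metis lookup_single_eq)
qed

lemma pvar_power_nonzero: "pvar i ^ a \<noteq> 0"
  by (metis lookup_single_eq lookup_zero pvar_power zero_neq_one)

lemma straightens_act:
  assumes "straightens m u a v"
  shows "excess u w = a + excess v w \<and> word_act u w = word_act v w"
proof -
  have "act_eval w f (word_elem u) = act_eval w f (scalar (pbeta ^ a) * word_elem v)" for f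
    using act_eval_ideal[OF assms[unfolded straightens_def], of w f] by (simp add: act_eval_diff)
  from this[of "\<lambda>z. if z = word_act u w then 1 else 0"]
  have eq: "pbeta ^ excess u w =
      pbeta ^ (a + excess v w) * (if word_act v w = word_act u w then 1 else 0)"
    by (simp add: act_eval_word act_eval_scalar_word power_add mult.assoc)
  then have act: "word_act v w = word_act u w"
    using pvar_power_nonzero[of 0 "excess u w"] by (auto split: if_splits)
  with eq have "excess u w = a + excess v w"
    using pvar_power_inj by simp
  with act show ?thesis
    by simp
qed

text \<open>
  The word \<open>u\<close> and the reduced word chosen for its Demazure product have the same normal form, because
  the action determines it.
\<close>

lemma word_elem_eq_e_perm:
  assumes u: "set u \<subseteq> {1..<m}"
  shows "word_elem u - scalar (pbeta ^ excess u id) * e_perm m (word_act u id) \<in> idc_ideal m"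
proof -
  have M: "{1..m - 1} \<subseteq> {1..<m}" and range: "{1..<m} \<subseteq> {1..m - 1}"
    by auto
  have "word_act u id permutes {1..m}"
    by (rule word_act_permutes[OF permutes_id u])
  then obtain r where r: "e_perm m (word_act u id) = word_elem r" "set r \<subseteq> {1..<m}"
    "word_act r id = word_act u id" "excess r id = 0"
    by (rule e_perm_word)
  obtain a v where v: "v \<in> normal_words (m - 1)" "straightens m u a v"
    using straightens_normal_word[OF M] u range by blast
  obtain b v' where v': "v' \<in> normal_words (m - 1)" "straightens m r b v'"
    using straightens_normal_word[OF M] r(2) range by blast
  have av: "excess u id = a + excess v id" "word_act u id = word_act v id"
    and bv: "excess r id = b + excess v' id" "word_act r id = word_act v' id"
    using straightens_act[OF v(2), of id] straightens_act[OF v'(2), of id] by blast+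
  have "word_act v' id = word_act v id"
    by (simp only: av(2)[symmetric] bv(2)[symmetric] r(3))
  then have "v' = v"
    by (rule normal_word_act_inj[OF v'(1) v(1)])
  moreover have "b = 0"
    using bv(1) r(4) by linarith
  ultimately have "straightens m v 0 r"
    using straightens_sym v'(2) by blast
  then have "straightens m u (a + 0) r"
    by (rule straightens_trans[OF v(2)])
  moreover have "a = excess u id"
    using av(1) normal_word_act[OF v(1)] by linarith
  ultimately show ?thesis
    by (simp only: straightens_def r(1) add_0_right)
qed

text \<open>The coefficient of \<open>w\<close> in the image of the identity permutation.\<close>

definition act_coeff :: "(nat \<Rightarrow> nat) \<Rightarrow> free_alg \<Rightarrow> poly" where
  "act_coeff w p = act_eval id (\<lambda>z. if z = w then 1 else 0) p"

lemma act_coeff_add: "act_coeff w (p + q) = act_coeff w p + act_coeff w q"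
  by (simp add: act_coeff_def act_eval_add)

lemma expansion_in_e_perm:
  assumes p: "p \<in> free_alg_on m"
  shows "p - (\<Sum>w | w permutes {1..m}. scalar (act_coeff w p) * e_perm m w) \<in> idc_ideal m"
proof (induction p rule: poly_mapping_single_add_induct)
  case (1 u c)
  have u: "set (letters u) \<subseteq> {1..<m}"
    using 1 p by (simp add: free_alg_on_def)
  let ?z = "word_act (letters u) id" and ?b = "pbeta ^ excess (letters u) id"
  have z: "?z permutes {1..m}"
    by (rule word_act_permutes[OF permutes_id u])
  have "(\<Sum>w | w permutes {1..m}. scalar (act_coeff w (Poly_Mapping.single u c)) * e_perm m w) =
    (\<Sum>w | w permutes {1..m}. if w = ?z then scalar (c * ?b) * e_perm m w else 0)"
    by (intro sum.cong) (simp_all add: act_coeff_def act_eval_single)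
  also have "\<dots> = scalar (c * ?b) * e_perm m ?z"
    using z by (simp add: finite_permutations)
  finally have "Poly_Mapping.single u c -
      (\<Sum>w | w permutes {1..m}. scalar (act_coeff w (Poly_Mapping.single u c)) * e_perm m w) =
      scalar c * (word_elem (letters u) - scalar ?b * e_perm m ?z)"
    by (simp add: single_eq_scalar_word scalar_mult algebra_simps)
  then show ?case
    using word_elem_eq_e_perm[OF u] by (simp add: idc_ideal_scalar)
next
  case 2
  show ?case
    by (simp add: act_coeff_def idc_ideal.zero)
next
  case (3 q r)
  from idc_ideal.add[OF this] show ?case
    by (simp add: act_coeff_add scalar_add distrib_right sum.distrib algebra_simps)
qed

lemma act_coeff_expansion:
  assumes "v permutes {1..m}"
  shows "act_coeff v (\<Sum>w | w permutes {1..m}. scalar (G w) * e_perm m w) = G v"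
proof -
  have "act_coeff v (\<Sum>w | w permutes {1..m}. scalar (G w) * e_perm m w) =
    (\<Sum>w | w permutes {1..m}. if w = v then G w else 0)"
    unfolding act_coeff_def act_eval_sum
  proof (rule sum.cong)
    fix w
    assume "w \<in> {w. w permutes {1..m}}"
    then obtain r where "e_perm m w = word_elem r" "word_act r id = w" "excess r id = 0"
      using e_perm_word[of w m] by blast
    then show "act_eval id (\<lambda>z. if z = v then 1 else 0) (scalar (G w) * e_perm m w) =
        (if w = v then G w else 0)"
      by (simp add: act_eval_scalar_word)
  qed simp
  then show ?thesis
    using assms by (simp add: finite_permutations)
qed

lemma A_product_in_free_alg_on: "A_product m \<in> free_alg_on m"
  unfolding A_product_def A_factor_def
  by (intro free_alg_on_prod_list)
    (auto intro!: free_alg_on_prod_list free_alg_on_add free_alg_on_mult word_in_free_alg_on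
      simp: h_factor_def)

lemma grothendieck_eq_act_coeff:
  assumes "w permutes {1..m}"
  shows "grothendieck m w = act_coeff w (A_product m)"
proof -
  let ?S = "\<lambda>G. \<Sum>w | w permutes {1..m}. scalar (G w) * e_perm m w"
  let ?G = "\<lambda>w. if w permutes {1..m} then act_coeff w (A_product m) else 0"
  have "?S ?G = ?S (\<lambda>w. act_coeff w (A_product m))"
    by (intro sum.cong) auto
  then have ex: "A_product m - ?S ?G \<in> idc_ideal m"
    using expansion_in_e_perm[OF A_product_in_free_alg_on] by simp
  have "grothendieck m = ?G"
    unfolding grothendieck_def
  proof (rule the_equality)
    show "(\<forall>w. \<not> w permutes {1..m} \<longrightarrow> ?G w = 0) \<and> A_product m - ?S ?G \<in> idc_ideal m"
      using ex by simp
    fix G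
    assume G: "(\<forall>w. \<not> w permutes {1..m} \<longrightarrow> G w = 0) \<and> A_product m - ?S G \<in> idc_ideal m"
    have "G v = act_coeff v (A_product m)" if v: "v permutes {1..m}" for v
    proof -
      have "act_coeff v (A_product m - ?S G) = 0"
        using G act_eval_ideal unfolding act_coeff_def by blast
      then show ?thesis
        using act_coeff_expansion[OF v, of G] by (simp add: act_coeff_def act_eval_diff)
    qed
    with G show "G = ?G"
      by auto
  qed
  with assms show ?thesis
    by simp
qed

section \<open>Expanding the product over subsets of the staircase\<close>

lemma act_eval_h_factor_mult:
  "act_eval w f (h_factor l x * p) =
    act_eval w f p + x * (pbeta ^ excess [l] w * act_eval (word_act [l] w) f p)"
proof -
  have "h_factor l x = 1 + Poly_Mapping.single (NCWord [l]) x"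
    by (simp add: h_factor_def single_eq_scalar_word)
  then show ?thesis
    by (simp only: distrib_right mult_1 act_eval_add act_eval_single_mult ncword.sel mult.assoc)
qed

lemma act_eval_prod_h_factors:
  assumes "distinct qs"
  shows "act_eval w f (prod_list (map (\<lambda>q. h_factor (lt q) (x q)) qs)) =
    (\<Sum>P\<in>Pow (set qs). (\<Prod>q\<in>P. x q) * (pbeta ^ excess (map lt (filter (\<lambda>q. q \<in> P) qs)) w *
      f (word_act (map lt (filter (\<lambda>q. q \<in> P) qs)) w)))"
  using assms
proof (induction qs arbitrary: w)
  case Nil
  show ?case
    using act_eval_word[of w f "[]"] by simp
next
  case (Cons q qs)
  define g where "g w P = (\<Prod>q\<in>P. x q) * (pbeta ^ excess (map lt (filter (\<lambda>q. q \<in> P) qs)) w *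
      f (word_act (map lt (filter (\<lambda>q. q \<in> P) qs)) w))" for w P
  define h where "h P = (\<Prod>q\<in>P. x q) * (pbeta ^ excess (map lt (filter (\<lambda>q. q \<in> P) (q # qs))) w *
      f (word_act (map lt (filter (\<lambda>q. q \<in> P) (q # qs))) w))" for P
  have q: "q \<notin> set qs" "distinct qs"
    using Cons.prems by auto
  have h1: "h P = g w P" if "P \<in> Pow (set qs)" for P
    using that q unfolding h_def g_def by auto
  have h2: "h (insert q P) = x q * (pbeta ^ excess [lt q] w * g (word_act [lt q] w) P)"
    if "P \<in> Pow (set qs)" for P
  proof -
    have "filter (\<lambda>r. r \<in> insert q P) (q # qs) = q # filter (\<lambda>r. r \<in> P) qs"
      using q by (auto intro: filter_cong)
    moreover have "finite P" "q \<notin> P"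
      using that q by (auto intro: finite_subset)
    ultimately show ?thesis
      unfolding h_def g_def
      by (simp only: prod.insert list.map excess.simps word_act.simps power_add) simp
  qed
  have "Pow (set (q # qs)) = Pow (set qs) \<union> insert q ` Pow (set qs)"
    by (simp add: Pow_insert)
  moreover have "inj_on (insert q) (Pow (set qs))"
    using q by (auto simp: inj_on_def)
  moreover have "Pow (set qs) \<inter> insert q ` Pow (set qs) = {}"
    using q by auto
  ultimately have "sum h (Pow (set (q # qs))) =
      sum h (Pow (set qs)) + (\<Sum>P\<in>Pow (set qs). h (insert q P))"
    by (simp add: sum.union_disjoint sum.reindex)
  also have "\<dots> = (\<Sum>P\<in>Pow (set qs). g w P) +
      x q * (pbeta ^ excess [lt q] w * (\<Sum>P\<in>Pow (set qs). g (word_act [lt q] w) P))"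
    by (simp only: h1 h2 sum_distrib_left cong: sum.cong)
  also have "\<dots> = act_eval w f (prod_list (map (\<lambda>q. h_factor (lt q) (x q)) (q # qs)))"
    using Cons.IH[OF q(2)] unfolding g_def by (simp only: list.map prod_list.Cons act_eval_h_factor_mult)
  finally show ?case
    unfolding h_def by (rule sym)
qed

text \<open>
  The letters in the product of the \<open>A\<^sub>i(x\<^sub>i)\<close> are indexed by cells \<open>(i, j)\<close>: the row \<open>i\<close> is the factor
  \<open>A\<^sub>i(x\<^sub>i)\<close>, and the letter is \<open>N + i - j\<close>. Since the letters in a row descend, \<open>j\<close> ascends. The parameter
  \<open>N \<ge> m\<close> only shifts the columns; later \<open>N = m + k\<close>, and the cells are diagonals of the \<open>N\<close>-gon
  or the side \<open>(1, N)\<close>.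
\<close>

definition cell_letter :: "nat \<Rightarrow> nat \<times> nat \<Rightarrow> nat" where
  "cell_letter N q = N + fst q - snd q"

definition cell_row :: "nat \<Rightarrow> nat \<Rightarrow> nat \<Rightarrow> (nat \<times> nat) list" where
  "cell_row N m i = map (\<lambda>l. (i, N + i - l)) (rev [i..<m])"

definition cells :: "nat \<Rightarrow> nat \<Rightarrow> (nat \<times> nat) list" where
  "cells N m = concat (map (cell_row N m) [1..<m])"

lemma set_cells:
  assumes "m \<le> N"
  shows "set (cells N m) = {(i, j). 1 \<le> i \<and> i + (N - m) < j \<and> j \<le> N}"
proof (intro set_eqI iffI)
  fix q
  assume "q \<in> set (cells N m)"
  then show "q \<in> {(i, j). 1 \<le> i \<and> i + (N - m) < j \<and> j \<le> N}"
    using assms by (auto simp: cells_def cell_row_def)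
next
  fix q
  assume q: "q \<in> {(i, j). 1 \<le> i \<and> i + (N - m) < j \<and> j \<le> N}"
  obtain i j where ij: "q = (i, j)"
    by (cases q)
  have "i \<in> {1..<m}" "N + i - j \<in> {i..<m}" "j = N + i - (N + i - j)"
    using q assms by (auto simp: ij)
  then show "q \<in> set (cells N m)"
    unfolding cells_def cell_row_def ij by force
qed

lemma distinct_cells:
  assumes "m \<le> N"
  shows "distinct (cells N m)"
  unfolding cells_def
proof (rule distinct_concat)
  have "inj_on (cell_row N m) (set [1..<m])"
  proof
    fix i j
    assume i: "i \<in> set [1..<m]" and eq: "cell_row N m i = cell_row N m j"
    from i have "i \<in> fst ` set (cell_row N m i)"
      by (auto simp: cell_row_def intro!: rev_image_eqI[of "(i, N + i - i)"])
    moreover have "fst ` set (cell_row N m j) \<subseteq> {j}"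
      by (auto simp: cell_row_def)
    ultimately have "i \<in> {j}"
      unfolding eq by (rule rev_subsetD)
    then show "i = j"
      by simp
  qed
  then show "distinct (map (cell_row N m) [1..<m])"
    by (simp add: distinct_map del: set_upt)
next
  fix ys
  assume "ys \<in> set (map (cell_row N m) [1..<m])"
  moreover have "inj_on (\<lambda>l. (i, N + i - l)) {i..<m}" for i
  proof
    fix l l'
    assume "l \<in> {i..<m}" "l' \<in> {i..<m}" "(i, N + i - l) = (i, N + i - l')"
    with assms show "l = l'"
      unfolding prod.inject atLeastLessThan_iff by linarith
  qed
  ultimately show "distinct ys"
    by (auto simp: cell_row_def distinct_map)
next
  fix ys zs
  assume "ys \<in> set (map (cell_row N m) [1..<m])" "zs \<in> set (map (cell_row N m) [1..<m])" "ys \<noteq> zs"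
  then show "set ys \<inter> set zs = {}"
    by (auto simp: cell_row_def)
qed

lemma A_product_eq_cells:
  assumes "m \<le> N"
  shows "A_product m = prod_list (map (\<lambda>q. h_factor (cell_letter N q) (pvar (fst q))) (cells N m))"
proof -
  have "A_factor m i (pvar i) =
      prod_list (map (\<lambda>q. h_factor (cell_letter N q) (pvar (fst q))) (cell_row N m i))" for i
    unfolding A_factor_def cell_row_def map_map
    by (rule arg_cong[of _ _ prod_list]) (use assms in \<open>auto simp: cell_letter_def\<close>)
  moreover have "prod_list (map f (concat (map g is))) = prod_list (map (\<lambda>i. prod_list (map f (g i))) is)"
    for f :: "nat \<times> nat \<Rightarrow> free_alg" and g :: "nat \<Rightarrow> (nat \<times> nat) list" and "is"
    by (induction "is") auto
  ultimately show ?thesis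
    unfolding A_product_def cells_def by simp
qed

text \<open>The subword of the letters in the cells of \<open>P\<close>.\<close>

definition subword :: "nat \<Rightarrow> nat \<Rightarrow> (nat \<times> nat) set \<Rightarrow> nat list" where
  "subword N m P = map (cell_letter N) (filter (\<lambda>q. q \<in> P) (cells N m))"

lemma grothendieck_eq_sum:
  assumes "w permutes {1..m}" "m \<le> N"
  shows "grothendieck m w = (\<Sum>P | P \<subseteq> set (cells N m) \<and> word_act (subword N m P) id = w.
    (\<Prod>q\<in>P. pvar (fst q)) * pbeta ^ excess (subword N m P) id)"
proof -
  have "grothendieck m w = (\<Sum>P\<in>Pow (set (cells N m)). (\<Prod>q\<in>P. pvar (fst q)) *
      (pbeta ^ excess (subword N m P) id * (if word_act (subword N m P) id = w then 1 else 0)))"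
    unfolding grothendieck_eq_act_coeff[OF assms(1)] act_coeff_def A_product_eq_cells[OF assms(2)]
      subword_def
    by (rule act_eval_prod_h_factors[OF distinct_cells[OF assms(2)]])
  also have "\<dots> = (\<Sum>P\<in>Pow (set (cells N m)). if word_act (subword N m P) id = w
      then (\<Prod>q\<in>P. pvar (fst q)) * pbeta ^ excess (subword N m P) id else 0)"
    by (rule sum.cong) auto
  also have "\<dots> = (\<Sum>P | P \<in> Pow (set (cells N m)) \<and> word_act (subword N m P) id = w.
      (\<Prod>q\<in>P. pvar (fst q)) * pbeta ^ excess (subword N m P) id)"
    by (subst sum.inter_filter) simp_all
  finally show ?thesis
    by simp
qed

section \<open>Inversions\<close>

text \<open>The inversions of \<open>w\<close> among the positions \<open>1, \<dots>, m\<close>, as pairs of positions.\<close>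

definition inversions :: "nat \<Rightarrow> (nat \<Rightarrow> nat) \<Rightarrow> (nat \<times> nat) set" where
  "inversions m w = {(p, q). 1 \<le> p \<and> p < q \<and> q \<le> m \<and> w q < w p}"

lemma finite_inversions: "finite (inversions m w)"
  by (rule finite_subset[of _ "{1..m} \<times> {1..m}"]) (auto simp: inversions_def)

lemma transpose_Suc_less:
  fixes p q i :: nat
  assumes "p < q" "(p, q) \<noteq> (i, i + 1)"
  shows "Transposition.transpose i (i + 1) p < Transposition.transpose i (i + 1) q"
  using assms unfolding Transposition.transpose_def prod.inject by (simp split: if_split) linarith

lemma card_inversions_swap:
  assumes i: "i \<in> {1..<m}" and asc: "w i < w (i + 1)"
  shows "card (inversions m (w \<circ> Transposition.transpose i (i + 1))) = Suc (card (inversions m w))"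
proof -
  let ?s = "Transposition.transpose i (i + 1)"
  have bound: "1 \<le> ?s p \<and> ?s p \<le> m \<longleftrightarrow> 1 \<le> p \<and> p \<le> m" for p
    using i by (auto simp: Transposition.transpose_def)
  have eq: "inversions m (w \<circ> ?s) = insert (i, i + 1) (map_prod ?s ?s ` inversions m w)"
  proof (intro set_eqI iffI)
    fix d
    assume d: "d \<in> inversions m (w \<circ> ?s)"
    obtain p q where pq: "d = (p, q)"
      by (cases d)
    show "d \<in> insert (i, i + 1) (map_prod ?s ?s ` inversions m w)"
    proof (cases "(p, q) = (i, i + 1)")
      case False
      then have "(?s p, ?s q) \<in> inversions m w"
        using d transpose_Suc_less[of p q i] bound[of p] bound[of q]
        by (auto simp: pq inversions_def simp del: One_nat_def)
      then have "map_prod ?s ?s (?s p, ?s q) \<in> map_prod ?s ?s ` inversions m w"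
        by (rule imageI)
      then show ?thesis
        by (simp add: pq)
    qed (simp add: pq)
  next
    fix d
    assume d: "d \<in> insert (i, i + 1) (map_prod ?s ?s ` inversions m w)"
    show "d \<in> inversions m (w \<circ> ?s)"
    proof (cases "d = (i, i + 1)")
      case True
      then show ?thesis
        using i asc by (simp add: inversions_def)
    next
      case False
      then obtain p q where pq: "d = (?s p, ?s q)" "(p, q) \<in> inversions m w"
        using d by auto
      then have "(p, q) \<noteq> (i, i + 1)"
        using asc by (auto simp: inversions_def)
      then show ?thesis
        using pq transpose_Suc_less[of p q i] bound[of p] bound[of q]
        by (auto simp: inversions_def simp del: One_nat_def)
    qed
  qed
  have "(i, i + 1) \<notin> map_prod ?s ?s ` inversions m w"
  proof
    assume "(i, i + 1) \<in> map_prod ?s ?s ` inversions m w"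
    then obtain p q where pq: "i = ?s p" "i + 1 = ?s q" "(p, q) \<in> inversions m w"
      by (auto simp: image_iff)
    have "p = ?s i" "q = ?s (i + 1)"
      using pq(1,2) by (metis transpose_involutory)+
    then have "p = i + 1" "q = i"
      by simp_all
    with pq(3) show False
      by (simp add: inversions_def)
  qed
  moreover have "inj_on (map_prod ?s ?s) (inversions m w)"
    by (rule inj_on_subset[OF prod.inj_map[OF inj_transpose inj_transpose]]) simp
  ultimately show ?thesis
    unfolding eq by (simp add: finite_inversions card_image)
qed

lemma inversions_word_act:
  assumes "set u \<subseteq> {1..<m}"
  shows "card (inversions m (word_act u w)) + excess u w = card (inversions m w) + length u"
  using assms
proof (induction u arbitrary: w)
  case (Cons i u)
  have "i \<in> {1..<m}"
    using Cons.prems by simp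
  from card_inversions_swap[OF this, of w] Cons.IH[of "sort_step i w"] Cons.prems show ?case
    by (cases "w i < w (i + 1)") (simp_all add: sort_step_def del: o_apply)
qed simp

section \<open>Counting large values left of a cut\<close>

text \<open>The number of values greater than \<open>T\<close> in the positions \<open>1, \<dots>, l\<close>.\<close>

definition cut :: "nat \<Rightarrow> (nat \<Rightarrow> nat) \<Rightarrow> nat \<Rightarrow> nat" where
  "cut T w l = card {p \<in> {1..l}. T < w p}"

lemma cut_0 [simp]: "cut T w 0 = 0"
  by (simp add: cut_def)

lemma cut_Suc: "cut T w (Suc l) = cut T w l + (if T < w (Suc l) then 1 else 0)"
proof -
  have "{p \<in> {1..Suc l}. T < w p} =
      (if T < w (Suc l) then insert (Suc l) {p \<in> {1..l}. T < w p} else {p \<in> {1..l}. T < w p})"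
    by (auto simp: le_Suc_eq)
  then show ?thesis
    by (simp add: cut_def)
qed

lemma cut_mono: "l \<le> l' \<Longrightarrow> cut T w l \<le> cut T w l'"
  unfolding cut_def by (rule card_mono) auto

lemma cut_id: "cut T id l = l - T"
  by (induction l) (auto simp: cut_Suc)

lemma cut_full:
  assumes "w permutes {1..m}"
  shows "cut T w m = m - T"
proof -
  have "w ` {p \<in> {1..m}. T < w p} = {q \<in> w ` {1..m}. T < q}"
    by blast
  also have "\<dots> = {T<..m}"
    unfolding permutes_image[OF assms] by auto
  finally have "card {p \<in> {1..m}. T < w p} = card {T<..m}"
    using card_image[of w "{p \<in> {1..m}. T < w p}"] permutes_inj_on[OF assms] by metis
  then show ?thesis
    by (simp add: cut_def)
qed

lemma cut_sort_step_other:
  assumes "1 \<le> i" "l \<noteq> i"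
  shows "cut T (sort_step i w) l = cut T w l"
proof (cases "w i < w (i + 1)")
  case True
  let ?s = "Transposition.transpose i (i + 1)"
  have "1 \<le> ?s p \<and> ?s p \<le> l \<longleftrightarrow> 1 \<le> p \<and> p \<le> l" for p
    using assms by (auto simp: Transposition.transpose_def)
  then have "{p \<in> {1..l}. T < w (?s p)} = ?s ` {p \<in> {1..l}. T < w p}"
    by (auto simp: in_transpose_image_iff simp del: One_nat_def)
  then show ?thesis
    using True by (simp add: cut_def sort_step_def card_image)
qed (simp add: sort_step_def)

lemma cut_sort_step_same:
  assumes "1 \<le> i"
  shows "cut T (sort_step i w) i = min (cut T w (i - 1) + 1) (cut T w (i + 1))"
proof -
  obtain j where j: "i = Suc j"
    using assms by (cases i) auto
  have "cut T (sort_step i w) i = cut T w j + (if T < sort_step i w i then 1 else 0)"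
    using cut_Suc[of T "sort_step i w" j] cut_sort_step_other[of i j T w] j by simp
  moreover have "sort_step i w i = max (w i) (w (i + 1))"
    by (simp add: sort_step_def)
  ultimately show ?thesis
    by (simp add: j cut_Suc less_max_iff_disj)
qed

lemma cut_sort_step_le:
  assumes "1 \<le> i"
  shows "cut T w l \<le> cut T (sort_step i w) l"
proof (cases "l = i")
  case True
  have "cut T w i \<le> cut T w (i - 1) + 1"
    using cut_Suc[of T w "i - 1"] assms by simp
  with True assms cut_mono[of i "i + 1" T w] show ?thesis
    by (simp add: cut_sort_step_same)
qed (use assms cut_sort_step_other[of i l T w] in simp)

lemma cut_word_act_le: "set u \<subseteq> {1..<m} \<Longrightarrow> cut T w l \<le> cut T (word_act u w) l"
proof (induction u arbitrary: w)
  case (Cons i u)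
  then show ?case
    using order_trans[OF cut_sort_step_le[of i T w l] Cons.IH[of "sort_step i w"]] by simp
qed simp

text \<open>
  After a letter \<open>l\<close>, some value greater than \<open>l\<close> is in the positions \<open>1, \<dots>, l\<close>, and later letters do
  not decrease the number of such values.
\<close>

lemma cut_word_act_letter_pos:
  assumes "w permutes {1..m}" "set u \<subseteq> {1..<m}" "l \<in> set u"
  shows "0 < cut l (word_act u w) l"
proof -
  obtain x y where u: "u = x @ l # y"
    using split_list[OF assms(3)] by blast
  define z where "z = word_act x w"
  have l: "1 \<le> l" "l < m" and y: "set y \<subseteq> {1..<m}"
    using assms(2) u by auto
  have z: "z permutes {1..m}"
    using assms(1,2) unfolding z_def u by (intro word_act_permutes) auto
  have "0 < cut l z (l + 1)"
  proof (rule ccontr)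
    assume "\<not> 0 < cut l z (l + 1)"
    then have "\<not> l < z p" if "p \<in> {1..l + 1}" for p
      using that by (auto simp: cut_def simp del: One_nat_def)
    moreover have "z p \<in> {1..m}" if "p \<in> {1..l + 1}" for p
      using that l permutes_in_image[OF z, of p] by auto
    ultimately have "z ` {1..l + 1} \<subseteq> {1..l}"
      by fastforce
    then have "card {1..l + 1} \<le> card {1..l}"
      using card_inj_on_le[of z "{1..l + 1}" "{1..l}"] permutes_inj_on[OF z] by auto
    then show False
      by simp
  qed
  then have "0 < cut l (sort_step l z) l"
    using l by (simp add: cut_sort_step_same)
  also have "\<dots> \<le> cut l (word_act y (sort_step l z)) l"
    by (rule cut_word_act_le[OF y])
  finally show ?thesis
    by (simp add: u z_def word_act_append)
qed

section \<open>Longest chains\<close>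

text \<open>A set of pairs that is totally ordered by the strict order in both coordinates.\<close>

definition chain :: "(nat \<times> nat) set \<Rightarrow> bool" where
  "chain S \<longleftrightarrow> (\<forall>d\<in>S. \<forall>e\<in>S. d \<noteq> e \<longrightarrow>
     (fst d < fst e \<and> snd d < snd e) \<or> (fst e < fst d \<and> snd e < snd d))"

lemma chainD:
  assumes "chain S" "d \<in> S" "(a, b) \<in> S" "d \<noteq> (a, b)"
  shows "fst d < a \<and> snd d < b \<or> a < fst d \<and> b < snd d"
  using bspec[OF bspec[OF assms(1)[unfolded chain_def] assms(2)] assms(3)] assms(4) by simp

lemma chain_subset: "chain S \<Longrightarrow> T \<subseteq> S \<Longrightarrow> chain T"
  unfolding chain_def by blast

lemma chain_inj_fst: "chain S \<Longrightarrow> inj_on fst S"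
  unfolding chain_def by (intro inj_onI) (metis less_irrefl)

lemma chain_inj_snd: "chain S \<Longrightarrow> inj_on snd S"
  unfolding chain_def by (intro inj_onI) (metis less_irrefl)

text \<open>
  In a chain of \<open>k + 1\<close> pairs inside the rectangle, every pair is a diagonal with at least \<open>k\<close> vertices
  strictly on each side: each of the other \<open>k\<close> pairs has an endpoint on either side of it.
\<close>

lemma chain_bounds:
  assumes S: "chain S" "S \<subseteq> {1..c} \<times> {c<..N}" "card S = Suc k" and d: "(a, b) \<in> S"
  shows "a + k < b" "b + k < N + a"
proof -
  define A where "A = {e \<in> S. fst e < a}"
  define B where "B = {e \<in> S. a < fst e}"
  have fin: "finite S"
    using S(3) card.infinite by fastforce
  have cases_S: "fst e < a \<and> snd e < b \<or> a < fst e \<and> b < snd e" if "e \<in> S" "e \<noteq> (a, b)" for e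
    using chainD[OF S(1) that(1) d that(2)] .
  have "S - {(a, b)} = A \<union> B"
  proof
    show "S - {(a, b)} \<subseteq> A \<union> B"
      using cases_S unfolding A_def B_def by blast
    show "A \<union> B \<subseteq> S - {(a, b)}"
      unfolding A_def B_def by auto
  qed
  moreover have "card (S - {(a, b)}) = k"
    using d S(3) fin by simp
  moreover have "A \<inter> B = {}"
    by (auto simp: A_def B_def)
  moreover have "finite A" "finite B"
    using fin by (simp_all add: A_def B_def)
  ultimately have k: "k = card A + card B"
    by (metis card_Un_disjoint)
  have A: "snd e < b" if "e \<in> A" for e
    using cases_S[of e] that unfolding A_def by fastforce
  have B: "b < snd e" if "e \<in> B" for e
    using cases_S[of e] that unfolding B_def by fastforce
  have inj: "inj_on fst A" "inj_on fst B" "inj_on snd A" "inj_on snd B"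
    using inj_on_subset[OF chain_inj_fst[OF S(1)]] inj_on_subset[OF chain_inj_snd[OF S(1)]]
    by (simp_all add: A_def B_def)
  have "card A \<le> card {1..<a}"
    using S(2) by (intro card_inj_on_le[OF inj(1)]) (auto simp: A_def)
  moreover have "card B \<le> card {a<..c}"
    using S(2) by (intro card_inj_on_le[OF inj(2)]) (auto simp: B_def)
  moreover have "card A \<le> card {c<..<b}"
    using S(2) A by (intro card_inj_on_le[OF inj(3)]) (auto simp: A_def)
  moreover have "card B \<le> card {b<..N}"
    using S(2) B by (intro card_inj_on_le[OF inj(4)]) (auto simp: B_def)
  moreover have "1 \<le> a" "a \<le> c" "c < b" "b \<le> N"
    using S(2) d by auto
  ultimately show "a + k < b" "b + k < N + a"
    using k by auto
qed

text \<open>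
  The recursion for the length \<open>L i j\<close> of a longest chain that avoids \<open>P\<close> in the rectangle
  \<open>{1..i} \<times> {c<..j}\<close>, on the domain \<open>i + k \<le> j \<le> N\<close>. The boundary value at \<open>j = i + k\<close> is
  \<open>i + k - c\<close>, as if no pair \<open>(a, b)\<close> with \<open>b \<le> a + k\<close> were in \<open>P\<close>; to the left of the rectangle, for
  \<open>j \<le> c\<close>, the value is nonpositive.
\<close>

locale chain_recursion =
  fixes k c N :: nat and P :: "(nat \<times> nat) set" and L :: "nat \<Rightarrow> nat \<Rightarrow> int"
  assumes k_le_c: "k \<le> c"
    and L_top: "\<And>j. j \<le> N \<Longrightarrow> L 0 j = - int (c - j)"
    and L_diag: "\<And>i. i + k \<le> N \<Longrightarrow> L i (i + k) = int (i + k) - int c"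
    and L_rec: "\<And>i j. 1 \<le> i \<Longrightarrow> i + k < j \<Longrightarrow> j \<le> N \<Longrightarrow> L i j =
      (if (i, j) \<in> P then max (L (i - 1) j) (L i (j - 1)) else L (i - 1) (j - 1) + 1)"
    and L_mono_row: "\<And>i j. 1 \<le> i \<Longrightarrow> i + k \<le> j \<Longrightarrow> j \<le> N \<Longrightarrow> L (i - 1) j \<le> L i j"
    and L_mono_col: "\<And>i j. i + k < j \<Longrightarrow> j \<le> N \<Longrightarrow> L i (j - 1) \<le> L i j"
begin

lemma L_left: "i + k \<le> j \<Longrightarrow> j \<le> N \<Longrightarrow> j \<le> c \<Longrightarrow> L i j \<le> int j - int c"
proof (induction "i + j" arbitrary: i j rule: less_induct)
  case less
  consider "i = 0" | "j = i + k" | "1 \<le> i" "i + k < j"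
    using less.prems by linarith
  then show ?case
  proof cases
    case 1
    with less.prems L_top[of j] show ?thesis
      by simp
  next
    case 2
    with less.prems L_diag[of i] show ?thesis
      by simp
  next
    case 3
    have "L (i - 1) (j - 1) \<le> int (j - 1) - int c"
      using less.prems 3 by (intro less.hyps) auto
    moreover have "L (i - 1) j \<le> int j - int c"
      using less.prems 3 by (intro less.hyps) auto
    moreover have "L i (j - 1) \<le> int (j - 1) - int c"
      using less.prems 3 by (intro less.hyps) auto
    ultimately show ?thesis
      using L_rec[OF 3 less.prems(2)] 3 by auto
  qed
qed

text \<open>
  The pairs with \<open>b \<le> a + k\<close> are allowed without restriction here, because of the boundary values.
\<close>

lemma chain_exists:
  "i + k \<le> j \<Longrightarrow> j \<le> N \<Longrightarrow> c \<le> j \<Longrightarrow>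
    \<exists>S. chain S \<and> S \<subseteq> {1..i} \<times> {c<..j} \<and> (\<forall>(a, b)\<in>S. a + k < b \<longrightarrow> (a, b) \<notin> P) \<and>
      L i j \<le> int (card S)"
proof (induction "i + j" arbitrary: i j rule: less_induct)
  case less
  have triv: ?case if "L i j \<le> 0"
    using that by (intro exI[of _ "{}"]) (auto simp: chain_def)
  consider "i = 0" | "j = c" | "j = i + k" | "1 \<le> i" "i + k < j" "c < j"
    using less.prems by linarith
  then show ?case
  proof cases
    case 1
    with less.prems L_top[of j] show ?thesis
      by (intro triv) simp
  next
    case 2
    with less.prems L_left[of i j] show ?thesis
      by (intro triv) simp
  next
    case 3
    \<comment> \<open>On the boundary, the pairs \<open>(s - k, s)\<close> form a chain with one pair in each column.\<close>
    let ?S = "(\<lambda>s. (s - k, s)) ` {c<..j}"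
    have "card ?S = j - c"
      by (subst card_image) (auto simp: inj_on_def)
    moreover have "L i j = int j - int c"
      using 3 L_diag[of i] less.prems by simp
    ultimately have "L i j \<le> int (card ?S)"
      using less.prems by simp
    moreover have "chain ?S"
      using k_le_c by (auto simp: chain_def)
    moreover have "?S \<subseteq> {1..i} \<times> {c<..j}"
      using 3 k_le_c by auto
    ultimately show ?thesis
      by (intro exI[of _ ?S]) auto
  next
    case 4
    show ?thesis
    proof (cases "(i, j) \<in> P")
      case True
      have 1: "\<exists>S. chain S \<and> S \<subseteq> {1..i - 1} \<times> {c<..j} \<and>
          (\<forall>(a, b)\<in>S. a + k < b \<longrightarrow> (a, b) \<notin> P) \<and> L (i - 1) j \<le> int (card S)"
        using less.prems 4 by (intro less.hyps) auto
      have 2: "\<exists>S. chain S \<and> S \<subseteq> {1..i} \<times> {c<..j - 1} \<and>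
          (\<forall>(a, b)\<in>S. a + k < b \<longrightarrow> (a, b) \<notin> P) \<and> L i (j - 1) \<le> int (card S)"
        using less.prems 4 by (intro less.hyps) auto
      have "{1..i - 1} \<times> {c<..j} \<subseteq> {1..i} \<times> {c<..j}" "{1..i} \<times> {c<..j - 1} \<subseteq> {1..i} \<times> {c<..j}"
        by auto
      moreover have "L i j = L (i - 1) j \<or> L i j = L i (j - 1)"
        using L_rec[OF 4(1,2) less.prems(2)] True by (simp add: max_def)
      ultimately show ?thesis
        using 1 2 by (metis (no_types, lifting) subset_trans)
    next
      case False
      have "\<exists>S. chain S \<and> S \<subseteq> {1..i - 1} \<times> {c<..j - 1} \<and>
          (\<forall>(a, b)\<in>S. a + k < b \<longrightarrow> (a, b) \<notin> P) \<and> L (i - 1) (j - 1) \<le> int (card S)"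
        using less.prems 4 by (intro less.hyps) auto
      then obtain S where S: "chain S" "S \<subseteq> {1..i - 1} \<times> {c<..j - 1}"
        "\<forall>(a, b)\<in>S. a + k < b \<longrightarrow> (a, b) \<notin> P" "L (i - 1) (j - 1) \<le> int (card S)"
        by blast
      have less_ij: "fst d < i \<and> snd d < j" if "d \<in> S" for d
        using subsetD[OF S(2) that] 4(1,2) by (auto simp: mem_Times_iff)
      have "finite S"
        using S(2) by (rule finite_subset) simp
      moreover have "(i, j) \<notin> S"
        using less_ij by fastforce
      ultimately have "L i j \<le> int (card (insert (i, j) S))"
        using S(4) L_rec[OF 4(1,2) less.prems(2)] False by simp
      moreover have "chain (insert (i, j) S)"
        using S(1) less_ij unfolding chain_def by simp
      moreover have "insert (i, j) S \<subseteq> {1..i} \<times> {c<..j}"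
        using S(2) 4 by fastforce
      ultimately show ?thesis
        using S(3) False by (intro exI[of _ "insert (i, j) S"]) auto
    qed
  qed
qed

lemma L_mono:
  assumes "i \<le> i'" "j \<le> j'" "i + k \<le> j" "i' + k \<le> j'" "j' \<le> N"
  shows "L i j \<le> L i' j'"
proof -
  have "j' \<le> N \<longrightarrow> L i j \<le> L i j'"
    using assms(2)
  proof (induction j' rule: dec_induct)
    case (step n)
    show ?case
      using L_mono_col[of i "Suc n"] step assms(3) by auto
  qed simp
  moreover have "i' + k \<le> j' \<longrightarrow> L i j' \<le> L i' j'"
    using assms(1)
  proof (induction i' rule: dec_induct)
    case (step n)
    show ?case
      using L_mono_row[of "Suc n" j'] step assms(5) by auto
  qed simp
  ultimately show ?thesis
    using assms by linarith
qed

lemma chain_card_le: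
  "chain S \<Longrightarrow> S \<subseteq> {1..i} \<times> {c<..j} \<Longrightarrow> (\<And>a b. (a, b) \<in> S \<Longrightarrow> a + k < b \<and> (a, b) \<notin> P) \<Longrightarrow>
    i + k \<le> j \<Longrightarrow> c \<le> j \<Longrightarrow> j \<le> N \<Longrightarrow> int (card S) \<le> L i j"
proof (induction "card S" arbitrary: S i j)
  case 0
  have "L 0 j \<le> L i j"
    using 0(5,7) by (intro L_mono) auto
  then show ?case
    using 0(1,6,7) L_top[of j] by simp
next
  case (Suc x)
  have fin: "finite S"
    using Suc.prems(2) by (rule finite_subset) simp
  define a where "a = Max (fst ` S)"
  have "S \<noteq> {}"
    using Suc.hyps(2) by auto
  then have "a \<in> fst ` S"
    unfolding a_def using fin by (intro Max_in) auto
  then obtain b where ab: "(a, b) \<in> S"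
    by auto
  have max: "fst d \<le> a" if "d \<in> S" for d
    using that fin unfolding a_def by simp
  have less_ab: "fst d < a \<and> snd d < b" if "d \<in> S - {(a, b)}" for d
    using chainD[OF Suc.prems(1) _ ab, of d] max[of d] that by (auto simp: not_less[symmetric])
  have ab_bounds: "1 \<le> a" "a \<le> i" "c < b" "b \<le> j" "a + k < b" "(a, b) \<notin> P"
    using subsetD[OF Suc.prems(2) ab] Suc.prems(3)[OF ab] by auto
  have "int (card (S - {(a, b)})) \<le> L (a - 1) (b - 1)"
  proof (rule Suc.hyps(1))
    show "x = card (S - {(a, b)})"
      using Suc.hyps(2) card.remove[OF fin ab] by linarith
    show "chain (S - {(a, b)})"
      using Suc.prems(1) by (rule chain_subset) auto
    show "S - {(a, b)} \<subseteq> {1..a - 1} \<times> {c<..b - 1}"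
    proof
      fix d
      assume d: "d \<in> S - {(a, b)}"
      with less_ab[OF d] subsetD[OF Suc.prems(2), of d] show "d \<in> {1..a - 1} \<times> {c<..b - 1}"
        by (auto simp: mem_Times_iff)
    qed
    show "a' + k < b' \<and> (a', b') \<notin> P" if "(a', b') \<in> S - {(a, b)}" for a' b'
      using Suc.prems(3)[of a' b'] that by blast
    show "a - 1 + k \<le> b - 1" "c \<le> b - 1" "b - 1 \<le> N"
      using ab_bounds Suc.prems(6) by linarith+
  qed
  moreover have "card S = Suc (card (S - {(a, b)}))"
    by (rule card.remove[OF fin ab])
  moreover have "L a b = L (a - 1) (b - 1) + 1"
    using L_rec[of a b] ab_bounds Suc.prems(6) by simp
  moreover have "L a b \<le> L i j"
    using ab_bounds Suc.prems(4,6) by (intro L_mono) auto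
  ultimately show ?case
    by linarith
qed

text \<open>
  By \<open>chain_bounds\<close>, a chain of \<open>k + 1\<close> pairs in the rectangle for \<open>c\<close> has no pair with \<open>b \<le> a + k\<close>, so
  the boundary values do not matter.
\<close>

lemma L_corner_le_iff:
  assumes "c + k \<le> N"
  shows "L c N \<le> int k \<longleftrightarrow> \<not> (\<exists>S. chain S \<and> S \<subseteq> {1..c} \<times> {c<..N} \<and> S \<inter> P = {} \<and> card S = Suc k)"
proof
  assume le: "L c N \<le> int k"
  show "\<not> (\<exists>S. chain S \<and> S \<subseteq> {1..c} \<times> {c<..N} \<and> S \<inter> P = {} \<and> card S = Suc k)"
  proof
    assume "\<exists>S. chain S \<and> S \<subseteq> {1..c} \<times> {c<..N} \<and> S \<inter> P = {} \<and> card S = Suc k"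
    then obtain S where S: "chain S" "S \<subseteq> {1..c} \<times> {c<..N}" "S \<inter> P = {}" "card S = Suc k"
      by (elim exE conjE)
    have "int (card S) \<le> L c N"
    proof (rule chain_card_le[OF S(1,2)])
      show "a + k < b \<and> (a, b) \<notin> P" if "(a, b) \<in> S" for a b
        using chain_bounds(1)[OF S(1,2,4) that] that S(3) by blast
      show "c \<le> N"
        using assms by simp
    qed (simp_all add: assms)
    with le S(4) show False
      by simp
  qed
next
  assume none: "\<not> (\<exists>S. chain S \<and> S \<subseteq> {1..c} \<times> {c<..N} \<and> S \<inter> P = {} \<and> card S = Suc k)"
  show "L c N \<le> int k"
  proof (rule ccontr)
    assume big: "\<not> L c N \<le> int k"
    have "c \<le> N"
      using assms by simp
    from chain_exists[OF assms order_refl this]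
    obtain S where S: "chain S" "S \<subseteq> {1..c} \<times> {c<..N}"
      "\<And>a b. (a, b) \<in> S \<Longrightarrow> a + k < b \<Longrightarrow> (a, b) \<notin> P" "L c N \<le> int (card S)"
      by (elim exE conjE) blast
    from big S(4) have "Suc k \<le> card S"
      by linarith
    then obtain T where T: "T \<subseteq> S" "card T = Suc k" "finite T"
      by (rule obtain_subset_with_card_n)
    have chain_T: "chain T"
      by (rule chain_subset[OF S(1) T(1)])
    have sub_T: "T \<subseteq> {1..c} \<times> {c<..N}"
      by (rule subset_trans[OF T(1) S(2)])
    have notin: "(a, b) \<notin> P" if "(a, b) \<in> T" for a b
      by (rule S(3)[OF subsetD[OF T(1) that] chain_bounds(1)[OF chain_T sub_T T(2) that]])
    have "T \<inter> P = {}"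
    proof (rule equals0I)
      fix d
      assume "d \<in> T \<inter> P"
      then show False
        using notin[of "fst d" "snd d"] by simp
    qed
    then have "\<exists>S. chain S \<and> S \<subseteq> {1..c} \<times> {c<..N} \<and> S \<inter> P = {} \<and> card S = Suc k"
      using chain_T sub_T T(2) by blast
    with none show False ..
  qed
qed

end

section \<open>The state of the sorting process\<close>

text \<open>
  The result of processing the letters \<open>m - 1, \<dots>, l\<close> of row \<open>i\<close>, as far as their cells lie in \<open>P\<close>,
  starting from \<open>w\<close>.
\<close>

definition row_state :: "nat \<Rightarrow> nat \<Rightarrow> (nat \<times> nat) set \<Rightarrow> nat \<Rightarrow> nat \<Rightarrow> (nat \<Rightarrow> nat) \<Rightarrow> nat \<Rightarrow> nat" where
  "row_state N m P i l w = word_act (filter (\<lambda>l. (i, N + i - l) \<in> P) (rev [l..<m])) w"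

text \<open>The permutation after the first \<open>i\<close> rows.\<close>

fun grid_state :: "nat \<Rightarrow> nat \<Rightarrow> (nat \<times> nat) set \<Rightarrow> nat \<Rightarrow> nat \<Rightarrow> nat" where
  "grid_state N m P 0 = id"
| "grid_state N m P (Suc i) = row_state N m P (Suc i) (Suc i) (grid_state N m P i)"

lemma row_state_step:
  assumes "l < m"
  shows "row_state N m P i l w = (if (i, N + i - l) \<in> P
    then sort_step l (row_state N m P i (Suc l) w) else row_state N m P i (Suc l) w)"
  using assms by (simp add: row_state_def upt_conv_Cons word_act_append del: upt_Suc)

lemma row_state_end: "m \<le> l \<Longrightarrow> row_state N m P i l w = w"
  by (simp add: row_state_def)

lemma row_state_permutes:
  assumes "1 \<le> l" "w permutes {1..m}"
  shows "row_state N m P i l w permutes {1..m}"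
  unfolding row_state_def using assms by (intro word_act_permutes) auto

lemma grid_state_permutes: "grid_state N m P i permutes {1..m}"
  by (induction i) (simp_all add: row_state_permutes permutes_id[unfolded id_def] id_def del: One_nat_def)

lemma cut_row_state_below:
  assumes "l' < l"
  shows "cut T (row_state N m P i l w) l' = cut T w l'"
proof (cases "l \<le> m")
  case True
  then show ?thesis
    using assms
    by (induction l rule: inc_induct) (auto simp: row_state_end row_state_step cut_sort_step_other)
qed (simp add: row_state_end)

lemma cut_row_state_above:
  assumes "1 \<le> l" "l \<le> l'"
  shows "cut T (row_state N m P i l w) l' = cut T (row_state N m P i l' w) l'"
  using assms(2,1)
proof (induction l rule: inc_induct)
  case (step l)
  then show ?case
    by (cases "l < m") (auto simp: row_state_step row_state_end cut_sort_step_other)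
qed simp

lemma subword_act:
  assumes "1 \<le> m" "m \<le> N"
  shows "word_act (subword N m P) id = grid_state N m P (m - 1)"
proof -
  let ?row = "\<lambda>i. filter (\<lambda>l. (i, N + i - l) \<in> P) (rev [i..<m])"
  have "map (cell_letter N) (filter (\<lambda>q. q \<in> P) (cell_row N m i)) = ?row i" for i
    unfolding cell_row_def filter_map map_map o_def
    by (rule map_idI) (use assms(2) in \<open>auto simp: cell_letter_def\<close>)
  then have sub: "subword N m P = concat (map ?row [1..<m])"
    unfolding subword_def cells_def filter_concat map_concat map_map o_def by (simp only:)
  have "word_act (concat (map ?row [1..<Suc n])) id = grid_state N m P n" for n
  proof (induction n)
    case (Suc n)
    have "[1..<Suc (Suc n)] = [1..<Suc n] @ [Suc n]"
      by simp
    then show ?case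
      using Suc.IH
      by (simp only: map_append concat_append word_act_append grid_state.simps row_state_def
        list.map concat.simps append_Nil2)
  qed simp
  from this[of "m - 1"] show ?thesis
    using assms(1) by (simp add: sub del: upt_Suc)
qed

lemma letters_subword:
  assumes "m \<le> N"
  shows "set (subword N m P) = cell_letter N ` (P \<inter> set (cells N m))"
  by (auto simp: subword_def)

lemma letters_subword_range:
  assumes "m \<le> N"
  shows "set (subword N m P) \<subseteq> {1..<m}"
  using assms unfolding letters_subword[OF assms] set_cells[OF assms]
  by (auto simp: cell_letter_def)

text \<open>
  The cut count at \<open>l\<close> just after the letter \<open>l\<close> of row \<open>i\<close>, for \<open>i = 0\<close> at the start. As the letters
  in a row descend and only \<open>l\<close> changes this count, it stays valid until the letter \<open>l\<close> of the next row.
\<close>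

definition cut_at :: "nat \<Rightarrow> nat \<Rightarrow> (nat \<times> nat) set \<Rightarrow> nat \<Rightarrow> nat \<Rightarrow> nat \<Rightarrow> nat" where
  "cut_at N m P T i l = cut T (if i = 0 then id else row_state N m P i l (grid_state N m P (i - 1))) l"

lemma cut_grid_state:
  assumes "i \<le> l"
  shows "cut T (grid_state N m P i) l = cut_at N m P T i l"
proof (cases i)
  case (Suc i')
  then show ?thesis
    using cut_row_state_above[of i l T N m P i "grid_state N m P i'"] assms
    by (simp add: cut_at_def)
qed (simp add: cut_at_def)

lemma cut_at_rec:
  assumes "1 \<le> i" "i \<le> l" "l < m"
  shows "cut_at N m P T i l = (if (i, N + i - l) \<in> P
    then min (cut_at N m P T (i - 1) (l - 1) + 1) (cut_at N m P T i (l + 1))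
    else cut_at N m P T (i - 1) l)"
proof -
  let ?g = "grid_state N m P (i - 1)"
  let ?w = "row_state N m P i (Suc l) ?g"
  have "cut T ?w (l - 1) = cut_at N m P T (i - 1) (l - 1)"
    using cut_row_state_below[of "l - 1" "Suc l" T N m P i ?g] cut_grid_state[of "i - 1" "l - 1" T N m P]
      assms by simp
  moreover have "cut T ?w l = cut_at N m P T (i - 1) l"
    using cut_row_state_below[of l "Suc l" T N m P i ?g] cut_grid_state[of "i - 1" l T N m P]
      assms by simp
  moreover have "cut T ?w (l + 1) = cut_at N m P T i (l + 1)"
    using assms by (simp add: cut_at_def)
  moreover have "cut_at N m P T i l = cut T (row_state N m P i l ?g) l"
    using assms by (simp add: cut_at_def)
  ultimately show ?thesis
    using row_state_step[OF assms(3), of N P i ?g] cut_sort_step_same[of l T ?w] assms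
    by (simp del: One_nat_def)
qed

lemma cut_at_mono_col:
  assumes "i \<le> l" "l < m"
  shows "cut_at N m P T i l \<le> cut_at N m P T i (l + 1)"
  using cut_grid_state[of i l T N m P] cut_grid_state[of i "l + 1" T N m P]
    cut_mono[of l "l + 1" T "grid_state N m P i"] assms by simp

lemma cut_at_end: "cut_at N m P T i m = m - T"
  using cut_full[OF grid_state_permutes[of N m P "i - 1"]]
  by (simp add: cut_at_def row_state_end cut_id)

lemma cut_at_Lipschitz:
  assumes "i \<le> l"
  shows "cut_at N m P T i (l + 1) \<le> cut_at N m P T i l + 1"
  using cut_grid_state[of i l T N m P] cut_grid_state[of i "l + 1" T N m P]
    cut_Suc[of T "grid_state N m P i" l] assms by (simp split: if_splits)

lemma cut_at_mono_row:
  assumes "1 \<le> i" "i \<le> l" "l \<le> m"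
  shows "cut_at N m P T i l \<le> cut_at N m P T (i - 1) (l - 1) + 1"
proof -
  have *: "cut_at N m P T (i - 1) l \<le> cut_at N m P T (i - 1) (l - 1) + 1"
    using cut_at_Lipschitz[of "i - 1" "l - 1" N m P T] assms by simp
  show ?thesis
  proof (cases "l = m")
    case True
    with * show ?thesis
      by (simp add: cut_at_end)
  next
    case False
    with * cut_at_rec[of i l m N P T] assms show ?thesis
      by auto
  qed
qed

lemma cut_grid_state_later:
  assumes "c \<le> i"
  shows "cut T (grid_state N m P i) c = cut T (grid_state N m P c) c"
  using assms by (induction i rule: dec_induct) (simp_all add: cut_row_state_below)

text \<open>
  The count at \<open>c\<close> for the threshold \<open>N - c\<close> is at most \<open>c - k\<close>, because only \<open>c - k\<close> values exceed
  \<open>N - c\<close>. It no longer changes after row \<open>c\<close>, whose last letter is \<open>c\<close>.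
\<close>

lemma cut_grid_state_full_iff:
  assumes c: "k < c" "c < m" and N: "N = m + k" and P: "P \<subseteq> set (cells N m)"
  shows "cut (N - c) (grid_state N m P (m - 1)) c = c - k \<longleftrightarrow>
    \<not> (\<exists>S. chain S \<and> S \<subseteq> {1..c} \<times> {c<..N} \<and> S \<inter> P = {} \<and> card S = Suc k)"
proof -
  define T where "T = N - c"
  define L where "L i j = int i - int (cut_at N m P T i (N + i - j))" for i j
  interpret chain_recursion k c N P L
  proof
    show "k \<le> c"
      using c by simp
    show "L 0 j = - int (c - j)" if "j \<le> N" for j
      using that c N by (simp add: L_def cut_at_def cut_id T_def)
    show "L i (i + k) = int (i + k) - int c" if "i + k \<le> N" for i
      using that c N by (simp add: L_def cut_at_end T_def)
    show "L i j = (if (i, j) \<in> P then max (L (i - 1) j) (L i (j - 1)) else L (i - 1) (j - 1) + 1)"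
      if ij: "1 \<le> i" "i + k < j" "j \<le> N" for i j
    proof -
      define l where "l = N + i - j"
      have l: "N + i - l = j" "N + (i - 1) - j = l - 1" "N + i - (j - 1) = l + 1"
        "N + (i - 1) - (j - 1) = l" "i \<le> l" "l < m"
        using ij N by (auto simp: l_def)
      have i1: "int (i - 1) = int i - 1"
        using ij(1) by (simp add: of_nat_diff)
      have L: "L i j = int i - int (cut_at N m P T i l)"
        "L (i - 1) j = int i - 1 - int (cut_at N m P T (i - 1) (l - 1))"
        "L i (j - 1) = int i - int (cut_at N m P T i (l + 1))"
        "L (i - 1) (j - 1) = int i - 1 - int (cut_at N m P T (i - 1) l)"
        unfolding L_def l(2,3,4) i1 by (simp_all only: l_def)
      show ?thesis
      proof (cases "(i, j) \<in> P")
        case True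
        then have "cut_at N m P T i l =
            min (cut_at N m P T (i - 1) (l - 1) + 1) (cut_at N m P T i (l + 1))"
          using cut_at_rec[OF ij(1) l(5,6), of N P T] unfolding l(1) by simp
        then have "int (cut_at N m P T i l) =
            min (int (cut_at N m P T (i - 1) (l - 1)) + 1) (int (cut_at N m P T i (l + 1)))"
          by simp
        with True L show ?thesis
          by (simp only: if_True) linarith
      next
        case False
        then have "cut_at N m P T i l = cut_at N m P T (i - 1) l"
          using cut_at_rec[OF ij(1) l(5,6), of N P T] unfolding l(1) by simp
        with False L show ?thesis
          by simp
      qed
    qed
    show "L (i - 1) j \<le> L i j" if ij: "1 \<le> i" "i + k \<le> j" "j \<le> N" for i j
    proof -
      have "N + (i - 1) - j = N + i - j - 1" "i \<le> N + i - j" "N + i - j \<le> m"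
        using ij N by auto
      then show ?thesis
        using cut_at_mono_row[of i "N + i - j" m N P T] ij(1) by (simp add: L_def)
    qed
    show "L i (j - 1) \<le> L i j" if "i + k < j" "j \<le> N" for i j
    proof -
      have "N + i - (j - 1) = N + i - j + 1" "i \<le> N + i - j" "N + i - j < m"
        using that N by auto
      then show ?thesis
        using cut_at_mono_col[of i "N + i - j" m N P T] by (simp add: L_def)
    qed
  qed
  have "cut T (grid_state N m P (m - 1)) c = cut T (grid_state N m P c) c"
    using c by (intro cut_grid_state_later) auto
  also have "\<dots> = cut_at N m P T c c"
    by (simp add: cut_grid_state)
  finally have "int (cut T (grid_state N m P (m - 1)) c) = int c - L c N"
    by (simp add: L_def)
  moreover have "cut T (grid_state N m P (m - 1)) c \<le> c - k"
  proof -
    have "m - T = c - k"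
      using c N by (simp add: T_def)
    then show ?thesis
      using cut_mono[of c m T "grid_state N m P (m - 1)"] cut_full[OF grid_state_permutes, of T N m P "m - 1"] c
      by simp
  qed
  ultimately have "cut T (grid_state N m P (m - 1)) c = c - k \<longleftrightarrow> L c N \<le> int k"
    using c by linarith
  then show ?thesis
    using L_corner_le_iff c N by (simp add: T_def)
qed

section \<open>Subwords with Demazure product \<open>1\<^sup>k \<times> w\<^sub>0\<close>\<close>

lemma w_perm_permutes: "w_perm k m permutes {1..m}"
proof -
  have "w_perm k m (w_perm k m y) = y" for y
    by (auto simp: w_perm_def)
  then have "\<exists>!x. w_perm k m x = y" for y
    by metis
  moreover have "w_perm k m x = x" if "x \<notin> {1..m}" for x
    using that by (auto simp: w_perm_def)
  ultimately show ?thesis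
    unfolding permutes_def by blast
qed

lemma word_act_fix: "(\<And>l. l \<in> set u \<Longrightarrow> p < l) \<Longrightarrow> word_act u w p = w p"
proof (induction u arbitrary: w)
  case (Cons i u)
  have "sort_step i w p = w p"
    using Cons.prems[of i] by (simp add: sort_step_def)
  with Cons show ?case
    by simp
qed simp

lemma cut_w_perm:
  assumes "k < c" "c < m"
  shows "cut (m + k - c) (w_perm k m) c = c - k"
proof -
  have "{p \<in> {1..c}. m + k - c < w_perm k m p} = {k<..c}"
    using assms by (auto simp: w_perm_def split: if_splits)
  then show ?thesis
    by (simp add: cut_def)
qed

text \<open>
  The counts are as large as they can be, so all values in the positions \<open>k + 1, \<dots>, c\<close> exceed
  \<open>m + k - c\<close>. Hence \<open>u\<close> is pointwise at least \<open>w_perm k m\<close>, and both have the same sum of values.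
\<close>

lemma eq_w_perm_of_cuts:
  assumes "k < m" and u: "u permutes {1..m}" and fixed: "\<And>p. p \<in> {1..k} \<Longrightarrow> u p = p"
    and cuts: "\<And>c. k < c \<Longrightarrow> c < m \<Longrightarrow> cut (m + k - c) u c = c - k"
  shows "u = w_perm k m"
proof
  have le: "w_perm k m p \<le> u p" if p: "p \<in> {1..m}" for p
  proof -
    consider "p \<le> k" | "k < p" "p < m" | "p = m"
      using p unfolding atLeastAtMost_iff by linarith
    then show ?thesis
    proof cases
      case 1
      then show ?thesis
        using p fixed[of p] by (simp add: w_perm_def)
    next
      case 2
      have "{q \<in> {1..p}. m + k - p < u q} \<subseteq> {k<..p}"
      proof
        fix q
        assume q: "q \<in> {q \<in> {1..p}. m + k - p < u q}"
        have "u q = q" if "q \<le> k"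
          using fixed[of q] that q by simp
        then have "k < q"
          using q 2 by fastforce
        with q show "q \<in> {k<..p}"
          by simp
      qed
      moreover have "card {q \<in> {1..p}. m + k - p < u q} = card {k<..p}"
        using cuts[OF 2] by (simp add: cut_def)
      ultimately have eq: "{q \<in> {1..p}. m + k - p < u q} = {k<..p}"
        by (intro card_subset_eq) simp_all
      have "p \<in> {q \<in> {1..p}. m + k - p < u q}"
        unfolding eq using 2 by simp
      then have "m + k - p < u p"
        by simp
      moreover have "w_perm k m p = m + 1 - (p - k)"
        using 2 by (simp add: w_perm_def)
      ultimately show ?thesis
        using 2 by linarith
    next
      case 3
      have "u m \<in> {1..m}"
        using permutes_in_image[OF u, of m] assms(1) by simp
      moreover have "\<not> u m \<le> k"
      proof
        assume "u m \<le> k"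
        then have "u (u m) = u m"
          using \<open>u m \<in> {1..m}\<close> by (intro fixed) simp
        then have "u m = m"
          by (rule injD[OF permutes_inj[OF u]])
        with \<open>u m \<le> k\<close> assms(1) show False
          by simp
      qed
      moreover have "w_perm k m m = k + 1"
        using assms(1) by (simp add: w_perm_def)
      ultimately show ?thesis
        unfolding 3 by linarith
    qed
  qed
  have "sum (w_perm k m) {1..m} = sum u {1..m}"
    using sum.permute[OF u, of "\<lambda>p. p"] sum.permute[OF w_perm_permutes[of k m], of "\<lambda>p. p"]
    by (simp add: o_def)
  then have "w_perm k m p = u p" if "p \<in> {1..m}" for p
    by (rule sum_mono_inv[OF _ le that]) simp_all
  then show "u p = w_perm k m p" for p
    using permutes_not_in[OF u, of p] permutes_not_in[OF w_perm_permutes[of k m], of p]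
    by (cases "p \<in> {1..m}") metis+
qed

text \<open>
  The diagonals of the \<open>N\<close>-gon with at least \<open>k\<close> vertices strictly on each side. They correspond to the
  cells whose letter exceeds \<open>k\<close>.
\<close>

definition relevant :: "nat \<Rightarrow> nat \<Rightarrow> (nat \<times> nat) set" where
  "relevant k N = {(i, j). 1 \<le> i \<and> i + k < j \<and> j \<le> N \<and> j + k < N + i}"

lemma relevant_eq_cells:
  "relevant k (m + k) = {q \<in> set (cells (m + k) m). k < cell_letter (m + k) q}"
  by (auto simp: relevant_def set_cells cell_letter_def)

lemma finite_relevant: "finite (relevant k N)"
  by (rule finite_subset[of _ "{1..N} \<times> {1..N}"]) (auto simp: relevant_def)

text \<open>No rectangle \<open>{1..c} \<times> {c<..N}\<close> contains a chain of \<open>k + 1\<close> pairs disjoint from \<open>P\<close>.\<close>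

definition avoids_chains :: "nat \<Rightarrow> nat \<Rightarrow> nat \<Rightarrow> (nat \<times> nat) set \<Rightarrow> bool" where
  "avoids_chains N m k P \<longleftrightarrow> (\<forall>c. k < c \<and> c < m \<longrightarrow>
     \<not> (\<exists>S. chain S \<and> S \<subseteq> {1..c} \<times> {c<..N} \<and> S \<inter> P = {} \<and> card S = Suc k))"

text \<open>
  The key equivalence. A letter \<open>l \<le> k\<close> would leave a value greater than \<open>l\<close> among the first \<open>l\<close>
  positions, which \<open>w_perm k m\<close> fixes.
\<close>

lemma subword_act_eq_w_perm_iff:
  assumes "k < m" and P: "P \<subseteq> set (cells (m + k) m)"
  shows "word_act (subword (m + k) m P) id = w_perm k m \<longleftrightarrow>
    P \<subseteq> relevant k (m + k) \<and> avoids_chains (m + k) m k P"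
proof -
  let ?N = "m + k"
  let ?u = "word_act (subword ?N m P) id"
  have range: "set (subword ?N m P) \<subseteq> {1..<m}"
    by (rule letters_subword_range) simp
  have u: "?u permutes {1..m}"
    by (rule word_act_permutes[OF permutes_id range])
  have state: "?u = grid_state ?N m P (m - 1)"
    using assms(1) by (intro subword_act) auto
  have cuts: "cut (?N - c) ?u c = c - k \<longleftrightarrow>
      \<not> (\<exists>S. chain S \<and> S \<subseteq> {1..c} \<times> {c<..?N} \<and> S \<inter> P = {} \<and> card S = Suc k)"
    if "k < c" "c < m" for c
    unfolding state by (rule cut_grid_state_full_iff[OF that refl P])
  show ?thesis
  proof
    assume eq: "?u = w_perm k m"
    have "k < cell_letter ?N q" if "q \<in> P" for q
    proof (rule ccontr)
      let ?l = "cell_letter ?N q"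
      assume "\<not> k < ?l"
      then have "{p \<in> {1..?l}. ?l < w_perm k m p} = {}"
        by (auto simp: w_perm_def)
      moreover have "?l \<in> set (subword ?N m P)"
        using that P letters_subword[of m ?N P] by auto
      then have "0 < cut ?l ?u ?l"
        by (rule cut_word_act_letter_pos[OF permutes_id range])
      ultimately show False
        unfolding eq cut_def by (simp only: card.empty less_irrefl)
    qed
    then have "P \<subseteq> relevant k ?N"
      using P unfolding relevant_eq_cells by blast
    moreover have "avoids_chains ?N m k P"
      unfolding avoids_chains_def using cuts cut_w_perm[of k _ m] eq by metis
    ultimately show "P \<subseteq> relevant k ?N \<and> avoids_chains ?N m k P" ..
  next
    assume R: "P \<subseteq> relevant k ?N \<and> avoids_chains ?N m k P"
    then have letters: "k < l" if "l \<in> set (subword ?N m P)" for l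
      using that letters_subword[of m ?N P] unfolding relevant_eq_cells by auto
    show "?u = w_perm k m"
    proof (rule eq_w_perm_of_cuts[OF assms(1) u])
      show "?u p = p" if "p \<in> {1..k}" for p
        using word_act_fix[of "subword ?N m P" p id] letters that by fastforce
      show "cut (?N - c) ?u c = c - k" if "k < c" "c < m" for c
        using cuts[OF that] R that unfolding avoids_chains_def by blast
    qed
  qed
qed

section \<open>Dissections\<close>

lemma cyc_eq:
  assumes "1 \<le> c" "c \<le> N" "b mod N = c mod N"
  shows "cyc N b = c"
  unfolding cyc_def
proof (rule the_equality)
  fix d
  assume d: "1 \<le> d \<and> d \<le> N \<and> b mod N = d mod N"
  then have "c mod N = d mod N"
    using assms(3) by simp
  then show "d = c"
    using assms(1,2) d by (cases "c = N"; cases "d = N") auto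
qed (use assms in simp)

lemma cyc_add:
  assumes "1 \<le> a" "a \<le> N" "r \<le> N"
  shows "cyc N (a + r) = (if a + r \<le> N then a + r else a + r - N)"
proof (cases "a + r \<le> N")
  case True
  then show ?thesis
    using assms by (auto intro: cyc_eq)
next
  case False
  then have "cyc N (a + r) = a + r - N"
    using assms by (intro cyc_eq) (auto simp: le_mod_geq)
  then show ?thesis
    using False by simp
qed

lemma minimal_dissection_eq:
  assumes "2 * k < N"
  shows "minimal_dissection k N = diagonals N - relevant k N"
proof (intro set_eqI iffI)
  fix d
  assume "d \<in> minimal_dissection k N"
  then obtain i j a r where d: "d = (i, j)" "i < j" "1 \<le> a" "a \<le> N" "2 \<le> r" "r \<le> k"
    and ij: "{i, j} = {a, cyc N (a + r)}"
    by (auto simp: minimal_dissection_def)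
  show "d \<in> diagonals N - relevant k N"
  proof (cases "a + r \<le> N")
    case True
    then have "{i, j} = {a, a + r}"
      using ij cyc_add[of a N r] d assms by simp
    then have "i = a" "j = a + r"
      using d(2) by (auto simp: doubleton_eq_iff)
    then show ?thesis
      using d True assms by (auto simp: diagonals_def relevant_def)
  next
    case False
    then have "{i, j} = {a, a + r - N}"
      using ij cyc_add[of a N r] d assms by simp
    then have "i = a + r - N" "j = a"
      using d assms by (auto simp: doubleton_eq_iff)
    then show ?thesis
      using d False assms by (auto simp: diagonals_def relevant_def)
  qed
next
  fix d
  assume assm: "d \<in> diagonals N - relevant k N"
  obtain i j where ij: "d = (i, j)"
    by (cases d)
  have d: "d = (i, j)" "1 \<le> i" "i + 2 \<le> j" "j \<le> N" "(i, j) \<noteq> (1, N)"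
    using assm by (simp_all add: ij diagonals_def)
  have short: "j \<le> i + k \<or> N + i \<le> j + k"
    using assm d(2-4) by (auto simp: ij relevant_def)
  have "\<exists>a r. 1 \<le> a \<and> a \<le> N \<and> 2 \<le> r \<and> r \<le> k \<and> {i, j} = {a, cyc N (a + r)}"
    using short
  proof
    assume "j \<le> i + k"
    then show ?thesis
      using d cyc_add[of i N "j - i"] by (intro exI[of _ i] exI[of _ "j - i"]) auto
  next
    assume "N + i \<le> j + k"
    moreover have "2 \<le> N + i - j"
      using d by auto
    moreover have "cyc N (j + (N + i - j)) = i"
      using d by (intro cyc_eq) auto
    ultimately show ?thesis
      using d by (intro exI[of _ j] exI[of _ "N + i - j"]) auto
  qed
  then show "d \<in> minimal_dissection k N"
    using d by (simp add: minimal_dissection_def)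
qed

lemma relevant_subset_diagonals: "0 < k \<Longrightarrow> relevant k N \<subseteq> diagonals N"
  by (auto simp: relevant_def diagonals_def)

lemma minimal_dissection_degree:
  assumes "0 < k" "2 * k < N" "v \<in> {1..N}"
  shows "2 * (k - 1) \<le> card {d \<in> minimal_dissection k N. fst d = v \<or> snd d = v}"
proof -
  let ?D = "{d \<in> minimal_dissection k N. fst d = v \<or> snd d = v}"
  define g where "g r = (if v + r \<le> N then (v, v + r) else (v + r - N, v))" for r
  let ?A = "{2..k} \<union> {N - k..N - 2}"
  have "finite ?D"
    by (rule finite_subset[of _ "{1..N} \<times> {1..N}"])
      (auto simp: minimal_dissection_eq[OF assms(2)] diagonals_def)
  moreover have "g r \<in> ?D" if r: "r \<in> ?A" for r
  proof (cases "v + r \<le> N")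
    case True
    have "g r = (v, v + r)"
      using True by (simp add: g_def)
    moreover have "2 \<le> r" "r \<le> N - 2" "r \<le> k \<or> N \<le> r + k"
      using r assms(2) by auto
    ultimately show ?thesis
      using assms True unfolding minimal_dissection_eq[OF assms(2)] diagonals_def relevant_def by auto
  next
    case False
    have "g r = (v + r - N, v)"
      using False by (simp add: g_def)
    moreover have "2 \<le> r" "r \<le> N - 2" "r \<le> k \<or> N \<le> r + k"
      using r assms(2) by auto
    ultimately show ?thesis
      using assms False unfolding minimal_dissection_eq[OF assms(2)] diagonals_def relevant_def by auto
  qed
  moreover have "inj_on g ?A"
  proof
    fix r s
    assume r: "r \<in> ?A" and s: "s \<in> ?A" and eq: "g r = g s"
    have "2 \<le> r" "r \<le> N - 2" "2 \<le> s" "s \<le> N - 2"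
      using r s assms(1,2) by auto
    with eq show "r = s"
      unfolding g_def by (cases "v + r \<le> N"; cases "v + s \<le> N") auto
  qed
  ultimately have "card ?A \<le> card ?D"
    by (intro card_inj_on_le[of g] image_subsetI)
  moreover have "card ?A = card {2..k} + card {N - k..N - 2}"
    using assms by (intro card_Un_disjoint) auto
  ultimately show ?thesis
    using assms by simp
qed

text \<open>
  Pairwise crossing diagonals form a chain in the rectangle for \<open>c\<close>, where \<open>c\<close> is the largest of their
  first endpoints; conversely, the pairs of a chain in such a rectangle cross, and they are relevant
  by \<open>chain_bounds\<close>.
\<close>

lemma crossing_family_iff_chain:
  assumes "0 < k" and E: "E \<subseteq> relevant k (m + k)"
    and D: "D \<subseteq> diagonals (m + k)" "E \<subseteq> D" "D \<inter> relevant k (m + k) \<subseteq> E"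
  shows "(\<exists>S\<subseteq>D. card S = k + 1 \<and> (\<forall>d\<in>S. \<forall>e\<in>S. d \<noteq> e \<longrightarrow> crossing d e)) \<longleftrightarrow>
    \<not> avoids_chains (m + k) m k (relevant k (m + k) - E)"
proof
  let ?N = "m + k"
  assume "\<exists>S\<subseteq>D. card S = k + 1 \<and> (\<forall>d\<in>S. \<forall>e\<in>S. d \<noteq> e \<longrightarrow> crossing d e)"
  then obtain S where S: "S \<subseteq> D" "card S = k + 1"
    and cr: "\<And>d e. d \<in> S \<Longrightarrow> e \<in> S \<Longrightarrow> d \<noteq> e \<Longrightarrow> crossing d e"
    by blast
  have fin: "finite S"
    using S(2) card.infinite by fastforce
  have "S \<noteq> {}"
    using S(2) by auto
  define c where "c = Max (fst ` S)"
  have "c \<in> fst ` S"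
    unfolding c_def using fin \<open>S \<noteq> {}\<close> by (intro Max_in) auto
  then obtain e where e: "e \<in> S" "fst e = c"
    by auto
  have chain: "chain S"
    using cr unfolding chain_def crossing_def by blast
  have box: "S \<subseteq> {1..c} \<times> {c<..?N}"
  proof
    fix d
    assume d: "d \<in> S"
    have "fst d \<le> c"
      using d fin unfolding c_def by simp
    moreover have "c < snd d"
    proof (cases "d = e")
      case True
      then show ?thesis
        using d e S(1) D(1) by (force simp: diagonals_def)
    next
      case False
      then show ?thesis
        using cr[OF d e(1)] e(2) \<open>fst d \<le> c\<close> by (auto simp: crossing_def)
    qed
    moreover have "1 \<le> fst d" "snd d \<le> ?N"
      using d S(1) D(1) by (force simp: diagonals_def)+
    ultimately show "d \<in> {1..c} \<times> {c<..?N}"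
      by (simp add: mem_Times_iff)
  qed
  have "card S \<le> card {1..c}"
    by (rule card_inj_on_le[OF chain_inj_fst[OF chain]]) (use box in auto)
  moreover have "card S \<le> card {c<..?N}"
    by (rule card_inj_on_le[OF chain_inj_snd[OF chain]]) (use box in auto)
  ultimately have "k < c" "c < m"
    using S(2) by auto
  moreover have "S \<inter> (relevant k ?N - E) = {}"
    using S(1) D(3) by blast
  ultimately show "\<not> avoids_chains ?N m k (relevant k ?N - E)"
    using chain box S(2) unfolding avoids_chains_def by auto
next
  let ?N = "m + k"
  assume "\<not> avoids_chains ?N m k (relevant k ?N - E)"
  then obtain c S where S: "chain S" "S \<subseteq> {1..c} \<times> {c<..?N}" "S \<inter> (relevant k ?N - E) = {}"
    "card S = Suc k"
    unfolding avoids_chains_def by blast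
  have "d \<in> relevant k ?N" if "d \<in> S" for d
    using chain_bounds[OF S(1,2,4), of "fst d" "snd d"] subsetD[OF S(2) that] that
    by (auto simp: relevant_def)
  then have "S \<subseteq> D"
    using S(3) D(2) by blast
  moreover have "crossing d e" if "d \<in> S" "e \<in> S" "d \<noteq> e" for d e
    using chainD[OF S(1) that(1), of "fst e" "snd e"] that subsetD[OF S(2) that(1)]
      subsetD[OF S(2) that(2)] by (auto simp: crossing_def mem_Times_iff)
  ultimately show "\<exists>S\<subseteq>D. card S = k + 1 \<and> (\<forall>d\<in>S. \<forall>e\<in>S. d \<noteq> e \<longrightarrow> crossing d e)"
    using S(4) by (intro exI[of _ S]) simp
qed

text \<open>The degree condition holds because the minimal dissection already satisfies it.\<close>

lemma k_dissection_iff: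
  assumes "0 < k" "k < m"
  shows "k_dissection k (m + k) D \<longleftrightarrow> minimal_dissection k (m + k) \<subseteq> D \<and> D \<subseteq> diagonals (m + k) \<and>
    avoids_chains (m + k) m k (relevant k (m + k) - D)"
proof -
  let ?N = "m + k"
  have N: "2 * k < ?N"
    using assms by simp
  have deg: "2 * (k - 1) \<le> card {d \<in> D. fst d = v \<or> snd d = v}"
    if "minimal_dissection k ?N \<subseteq> D" "D \<subseteq> diagonals ?N" "v \<in> {1..?N}" for v
  proof -
    have "finite D"
      using that(2) by (rule finite_subset)
        (auto intro: finite_subset[of _ "{1..?N} \<times> {1..?N}"] simp: diagonals_def)
    then have "card {d \<in> minimal_dissection k ?N. fst d = v \<or> snd d = v} \<le>
        card {d \<in> D. fst d = v \<or> snd d = v}"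
      using that(1) by (intro card_mono) auto
    with minimal_dissection_degree[OF assms(1) N that(3)] show ?thesis
      by linarith
  qed
  have "relevant k ?N - D = relevant k ?N - D \<inter> relevant k ?N"
    by blast
  then have "(\<exists>S\<subseteq>D. card S = k + 1 \<and> (\<forall>d\<in>S. \<forall>e\<in>S. d \<noteq> e \<longrightarrow> crossing d e)) \<longleftrightarrow>
      \<not> avoids_chains ?N m k (relevant k ?N - D)" if "D \<subseteq> diagonals ?N"
    using crossing_family_iff_chain[OF assms(1), of "D \<inter> relevant k ?N" m D] that by simp
  with deg show ?thesis
    unfolding k_dissection_def by blast
qed

section \<open>Counting and weights\<close>

lemma relevant_eq_Sigma:
  assumes "k \<le> n"
  shows "relevant k (n + 1 + k) = Sigma {1..n} (\<lambda>i. {i + k<..i + k + min (n - i + 1) (n - k)})"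
proof -
  have "1 \<le> i \<and> i + k < j \<and> j \<le> n + 1 + k \<and> j + k < n + 1 + k + i \<longleftrightarrow>
      (1 \<le> i \<and> i \<le> n) \<and> i + k < j \<and> j \<le> i + k + min (n - i + 1) (n - k)" for i j
    using assms by linarith
  then show ?thesis
    unfolding relevant_def Sigma_def by (auto simp del: One_nat_def)
qed

lemma prod_relevant:
  fixes g :: "nat \<Rightarrow> 'a::comm_monoid_mult"
  assumes "k \<le> n"
  shows "(\<Prod>q\<in>relevant k (n + 1 + k). g (fst q)) = (\<Prod>a = 1..n. g a ^ min (n - a + 1) (n - k))"
proof -
  have "(\<Prod>q\<in>relevant k (n + 1 + k). g (fst q)) =
      (\<Prod>a = 1..n. \<Prod>j\<in>{a + k<..a + k + min (n - a + 1) (n - k)}. g a)"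
    unfolding relevant_eq_Sigma[OF assms] by (subst prod.Sigma) (auto intro: prod.cong)
  then show ?thesis
    by simp
qed

lemma card_relevant:
  assumes "k \<le> n"
  shows "card (relevant k (n + 1 + k)) = k * (n - k) + card (inversions (n + 1) (w_perm k (n + 1)))"
proof -
  have "inversions (n + 1) (w_perm k (n + 1)) = Sigma {k<..n} (\<lambda>p. {p<..n + 1})"
    by (auto simp: inversions_def w_perm_def split: if_splits)
  then have inv: "card (inversions (n + 1) (w_perm k (n + 1))) = (\<Sum>p\<in>{k<..n}. n + 1 - p)"
    by simp
  have "{1..n} = {1..k} \<union> {k<..n}"
    using assms by auto
  then have "card (relevant k (n + 1 + k)) =
      (\<Sum>i\<in>{1..k}. min (n - i + 1) (n - k)) + (\<Sum>i\<in>{k<..n}. min (n - i + 1) (n - k))"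
    unfolding relevant_eq_Sigma[OF assms] by (simp add: sum.union_disjoint ivl_disj_int)
  also have "(\<Sum>i\<in>{1..k}. min (n - i + 1) (n - k)) = (\<Sum>i\<in>{1..k}. n - k)"
    by (intro sum.cong) auto
  also have "(\<Sum>i\<in>{k<..n}. min (n - i + 1) (n - k)) = (\<Sum>p\<in>{k<..n}. n + 1 - p)"
    by (intro sum.cong) auto
  finally show ?thesis
    unfolding inv by simp
qed

text \<open>
  Every letter either creates an inversion or contributes to the excess, and the relevant diagonals
  outnumber the inversions of \<open>w_perm k (n + 1)\<close> by \<open>k * (n - k)\<close>.
\<close>

lemma excess_subword:
  assumes "k \<le> n" "P \<subseteq> relevant k (n + 1 + k)"
    and act: "word_act (subword (n + 1 + k) (n + 1) P) id = w_perm k (n + 1)"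
  shows "card (relevant k (n + 1 + k) - P) + excess (subword (n + 1 + k) (n + 1) P) id = k * (n - k)"
proof -
  let ?N = "n + 1 + k" and ?m = "n + 1"
  have "inversions ?m id = {}"
    by (auto simp: inversions_def)
  then have "card (inversions ?m (w_perm k ?m)) + excess (subword ?N ?m P) id = length (subword ?N ?m P)"
    using inversions_word_act[OF letters_subword_range[of ?m ?N P], of id] unfolding act by simp
  moreover have "set (filter (\<lambda>q. q \<in> P) (cells ?N ?m)) = P"
    using assms(2) relevant_eq_cells[of k ?m] by auto
  then have "length (subword ?N ?m P) = card P"
    using distinct_card[OF distinct_filter[OF distinct_cells[of ?m ?N], of "\<lambda>q. q \<in> P"]]
    by (simp add: subword_def)
  moreover have "card (relevant k ?N - P) = card (relevant k ?N) - card P" "card P \<le> card (relevant k ?N)"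
    using assms(2) finite_relevant[of k ?N] finite_subset[OF assms(2)]
    by (simp_all add: card_Diff_subset card_mono)
  ultimately show ?thesis
    using card_relevant[OF assms(1)] by linarith
qed

lemma lvar_power_inv: "lvar i ^ (a + b) * lvar_inv i ^ b = lvar i ^ a"
  by (simp add: power_add mult.assoc lvar_lvar_inv flip: power_mult_distrib)

lemma complement_weight:
  assumes "finite R" "P \<subseteq> R"
  shows "(\<Prod>q\<in>R. lvar (f q)) * (\<Prod>q\<in>P. lvar_inv (f q)) = (\<Prod>q\<in>R - P. lvar (f q))"
proof -
  have "(\<Prod>q\<in>R. lvar (f q)) * (\<Prod>q\<in>P. lvar_inv (f q)) =
      (\<Prod>q\<in>R - P. lvar (f q)) * (\<Prod>q\<in>P. lvar (f q) * lvar_inv (f q))"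
    by (simp add: prod.subset_diff[OF assms(2,1)] prod.distrib mult.assoc)
  then show ?thesis
    by (simp add: lvar_lvar_inv)
qed

theorem theorem5p6:
  fixes n k :: nat
  assumes "0 < k" and "k \<le> n"
  shows "poly_subst lvar (dissection_poly k (n + k + 1)) =
    lvar 0 ^ (k * (n - k)) * (\<Prod>a = 1..n. lvar a ^ min (n - a + 1) (n - k)) *
    poly_subst lvar_inv (grothendieck (n + 1) (w_perm k (n + 1)))"
proof -
  define m where "m = n + 1"
  define N where "N = m + k"
  define R where "R = relevant k N"
  define D0 where "D0 = minimal_dissection k N"
  let ?word = "subword N m"
  let ?Ps = "{P. P \<subseteq> set (cells N m) \<and> word_act (?word P) id = w_perm k m}"
  let ?pre = "lvar 0 ^ (k * (n - k)) * (\<Prod>a = 1..n. lvar a ^ min (n - a + 1) (n - k))"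
  have km: "k < m" and N: "n + k + 1 = N" "N = n + 1 + k"
    using assms by (auto simp: m_def N_def)
  have R_diag: "R \<subseteq> diagonals N" and D0: "D0 = diagonals N - R"
    using relevant_subset_diagonals[OF assms(1)] minimal_dissection_eq[of k N] km
    by (auto simp: R_def D0_def N_def)
  have R_cells: "R \<subseteq> set (cells N m)"
    using relevant_eq_cells[of k m] by (auto simp: R_def N_def)
  have finR: "finite R"
    by (simp add: R_def finite_relevant)
  have P_iff: "P \<in> ?Ps \<longleftrightarrow> P \<subseteq> R \<and> avoids_chains N m k P" for P
    using subword_act_eq_w_perm_iff[OF km, of P] R_cells unfolding N_def R_def by blast
  have D_iff: "k_dissection k N D \<longleftrightarrow> D0 \<subseteq> D \<and> D \<subseteq> diagonals N \<and> avoids_chains N m k (R - D)" for D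
    using k_dissection_iff[OF assms(1) km, of D] by (simp add: N_def R_def D0_def)
  have weight: "?pre * ((\<Prod>q\<in>P. lvar_inv (fst q)) * lvar_inv 0 ^ excess (?word P) id) =
      lvar 0 ^ card (R - P) * (\<Prod>q\<in>R - P. lvar (fst q))" if "P \<in> ?Ps" for P
  proof -
    have PR: "P \<subseteq> R"
      by (rule conjunct1[OF iffD1[OF P_iff that]])
    have act: "word_act (?word P) id = w_perm k m"
      by (rule conjunct2[OF that[unfolded mem_Collect_eq]])
    have "card (R - P) + excess (?word P) id = k * (n - k)"
      using excess_subword[OF assms(2), of P] PR act by (simp add: R_def N(2) m_def)
    then have beta: "lvar 0 ^ (k * (n - k)) * lvar_inv 0 ^ excess (?word P) id = lvar 0 ^ card (R - P)"
      using lvar_power_inv[of 0 "card (R - P)" "excess (?word P) id"] by simp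
    have "(\<Prod>a = 1..n. lvar a ^ min (n - a + 1) (n - k)) = (\<Prod>q\<in>R. lvar (fst q))"
      unfolding R_def N(2) by (rule prod_relevant[OF assms(2), symmetric])
    then have xs: "(\<Prod>a = 1..n. lvar a ^ min (n - a + 1) (n - k)) * (\<Prod>q\<in>P. lvar_inv (fst q)) =
        (\<Prod>q\<in>R - P. lvar (fst q))"
      using complement_weight[OF finR PR, of fst] by (simp only:)
    have "?pre * ((\<Prod>q\<in>P. lvar_inv (fst q)) * lvar_inv 0 ^ excess (?word P) id) =
        (lvar 0 ^ (k * (n - k)) * lvar_inv 0 ^ excess (?word P) id) *
        ((\<Prod>a = 1..n. lvar a ^ min (n - a + 1) (n - k)) * (\<Prod>q\<in>P. lvar_inv (fst q)))"
      by (simp only: ac_simps)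
    then show ?thesis
      unfolding beta xs .
  qed
  have "poly_subst lvar (dissection_poly k N) =
      (\<Sum>D | k_dissection k N D. lvar 0 ^ card (D - D0) * (\<Prod>q\<in>D - D0. lvar (fst q)))"
    unfolding dissection_poly_def D0_def[symmetric]
    by (simp only: poly_subst_sum poly_subst_mult poly_subst_power poly_subst_prod poly_subst_pvar
      case_prod_unfold)
  also have "\<dots> = (\<Sum>P\<in>?Ps. lvar 0 ^ card (R - P) * (\<Prod>q\<in>R - P. lvar (fst q)))"
  proof (rule sum.reindex_bij_witness[of _ "\<lambda>P. D0 \<union> (R - P)" "\<lambda>D. R - D"])
    fix D
    assume "D \<in> {D. k_dissection k N D}"
    then have D: "D0 \<subseteq> D" "D \<subseteq> diagonals N" "avoids_chains N m k (R - D)"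
      using D_iff by blast+
    show "D0 \<union> (R - (R - D)) = D"
      using D(1,2) D0 by blast
    show "R - D \<in> ?Ps"
      by (rule iffD2[OF P_iff]) (simp add: D(3) Diff_subset)
    have "R - (R - D) = D - D0"
      using D(2) D0 R_diag by blast
    then show "lvar 0 ^ card (R - (R - D)) * (\<Prod>q\<in>R - (R - D). lvar (fst q)) =
        lvar 0 ^ card (D - D0) * (\<Prod>q\<in>D - D0. lvar (fst q))"
      by (simp only:)
  next
    fix P
    assume "P \<in> ?Ps"
    then have P: "P \<subseteq> R" "avoids_chains N m k P"
      using P_iff by blast+
    show inv: "R - (D0 \<union> (R - P)) = P"
      using P(1) D0 by blast
    have "D0 \<union> (R - P) \<subseteq> diagonals N"
      using D0 R_diag by blast
    then show "D0 \<union> (R - P) \<in> {D. k_dissection k N D}"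
      unfolding mem_Collect_eq D_iff inv using P(2) by blast
  qed
  also have "\<dots> = (\<Sum>P\<in>?Ps. ?pre * ((\<Prod>q\<in>P. lvar_inv (fst q)) * lvar_inv 0 ^ excess (?word P) id))"
    using weight by (intro sum.cong) auto
  also have "\<dots> = ?pre * poly_subst lvar_inv (grothendieck m (w_perm k m))"
    unfolding grothendieck_eq_sum[OF w_perm_permutes[of k m], of N, unfolded N_def, OF le_add1]
    by (simp add: poly_subst_sum poly_subst_mult poly_subst_power poly_subst_prod sum_distrib_left N_def)
  finally show ?thesis
    by (simp only: N(1) m_def)
qed

end
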